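(* Let $(A,B,P)$ be an $\mathbb E$-contraction on a Hilbert space $\mathcal H$, and let $$\mathcal Z=\{x\in\mathcal H:\langle P^kx,y\rangle\to0\text{ as }k\to\infty\text{ for all }y\in\mathcal H\}.$$ Then: (1) $\mathcal Z$ and $\mathcal Z^\perp$ reduce $A$ and $B$; (2) $(A|_{\mathcal Z},B|_{\mathcal Z},P|_{\mathcal Z})$ is a weakly stable $\mathbb E$-contraction; (3) $(A|_{\mathcal Z^\perp},B|_{\mathcal Z^\perp},P|_{\mathcal Z^\perp})$ is an $\mathbb E$-unitary.
   Context: All operators are bounded linear operators on complex Hilbert spaces. A closed subspace reduces $T$ if it is invariant under $T$ and $T^*$. The tetrablock is $\mathbb E=\{(x_1,x_2,x_3)\in\mathbb C^3:1-zx_1-wx_2+zwx_3\ne0\ \ \forall z,w\in\overline{\mathbb D}\}$, and $b\mathbb E=\{(a,b,p)\in\overline{\mathbb E}:|p|=1\}$. A compact set $K\subset\mathbb C^3$ is a spectral set for a commuting triple $\underline T$ if the Taylor joint spectrum of $\underline T$ lies in $K$ and $\|f(\underline T)\|\le\sup_K|f|$ for every rational function $f$ with poles off $K$. An $\mathbb E$-contraction is a commuting triple $(A,B,P)$ having $\overline{\mathbb E}$ as a spectral set (then $P$ is a contraction). An $\mathbb E$-unitary is a commuting triple of normal operators with Taylor joint spectrum contained in $b\mathbb E$. An $\mathbb E$-contraction $(A,B,P)$ is weakly stable if $\langle P^kx,y\rangle\to0$ as $k\to\infty$ for all $x,y$. Foguel's theorem: for a contraction $P$, the set $\mathcal Z$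 above is a (closed) subspace reducing $P$, $P|_{\mathcal Z}$ is a weakly stable contraction and $P|_{\mathcal Z^\perp}$ is unitary. *)

theory Defs
  imports "HOL-Analysis.Analysis" "HOL-Library.Poly_Mapping"
begin

text \<open>
  Complex Hilbert spaces. The inner product \<open>cinner\<close> is linear in its first argument; norm, metric
  and topology are those of the underlying real inner product \<open>Re (cinner x y)\<close>.
\<close>

class complex_hilbert_space = real_inner + complete_space +
  fixes scaleC :: "complex \<Rightarrow> 'a \<Rightarrow> 'a"  (infixr "*\<^sub>C" 75)
    and cinner :: "'a \<Rightarrow> 'a \<Rightarrow> complex"
  assumes scaleC_add_right: "c *\<^sub>C (x + y) = c *\<^sub>C x + c *\<^sub>C y"
    and scaleC_add_left: "(c + d) *\<^sub>C x = c *\<^sub>C x + d *\<^sub>C x"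
    and scaleC_scaleC: "c *\<^sub>C (d *\<^sub>C x) = (c * d) *\<^sub>C x"
    and scaleR_eq_scaleC: "r *\<^sub>R x = complex_of_real r *\<^sub>C x"
    and cinner_commute: "cinner x y = cnj (cinner y x)"
    and cinner_add_left: "cinner (x + y) z = cinner x z + cinner y z"
    and cinner_scaleC_left: "cinner (c *\<^sub>C x) y = c * cinner x y"
    and inner_eq_Re_cinner: "inner x y = Re (cinner x y)"

instantiation complex :: complex_hilbert_space
begin

definition scaleC_complex :: "complex \<Rightarrow> complex \<Rightarrow> complex"
  where "scaleC_complex c x = c * x"

definition cinner_complex :: "complex \<Rightarrow> complex \<Rightarrow> complex"
  where "cinner_complex x y = x * cnj y"

instance
  by standard
    (auto simp: scaleC_complex_def cinner_complex_def inner_complex_def algebra_simps scaleR_conv_of_real)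

end

text \<open>
  Restrictions to closed subspaces of an ambient space have to be treated as operators on Hilbert
  spaces in their own right. So every notion below is relative to a carrier \<open>M\<close>, a closed subspace
  of the ambient type regarded as a Hilbert space. An operator on \<open>M\<close> is given by a function on the
  ambient type of which only the values on \<open>M\<close> matter; the restriction of \<open>T\<close> to \<open>M\<close> is thus \<open>T\<close>
  itself, considered on \<open>M\<close>. The whole space is the case \<open>M = UNIV\<close>.
\<close>

definition closed_csubspace :: "'a::complex_hilbert_space set \<Rightarrow> bool" where
  "closed_csubspace M \<longleftrightarrow> closed M \<and> 0 \<in> M \<and> (\<forall>x\<in>M. \<forall>y\<in>M. x + y \<in> M) \<and> (\<forall>c. \<forall>x\<in>M. c *\<^sub>C x \<in> M)"

definition ortho_compl :: "'a::complex_hilbert_space set \<Rightarrow> 'a set" where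
  "ortho_compl M = {y. \<forall>x\<in>M. cinner x y = 0}"

definition bounded_op :: "'a::complex_hilbert_space set \<Rightarrow> ('a \<Rightarrow> 'a) \<Rightarrow> bool" where
  "bounded_op M T \<longleftrightarrow> T ` M \<subseteq> M \<and>
     (\<forall>x\<in>M. \<forall>y\<in>M. T (x + y) = T x + T y) \<and> (\<forall>c. \<forall>x\<in>M. T (c *\<^sub>C x) = c *\<^sub>C T x) \<and>
     (\<exists>C. \<forall>x\<in>M. norm (T x) \<le> C * norm x)"

definition opnorm :: "'a::complex_hilbert_space set \<Rightarrow> ('a \<Rightarrow> 'a) \<Rightarrow> real" where
  "opnorm M T = (SUP x\<in>M. norm (T x) / norm x)"

text \<open>For a bounded operator the vector described here exists and is unique, by Riesz.\<close>

definition adj :: "'a::complex_hilbert_space set \<Rightarrow> ('a \<Rightarrow> 'a) \<Rightarrow> 'a \<Rightarrow> 'a" where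
  "adj M T y = (THE z. z \<in> M \<and> (\<forall>x\<in>M. cinner (T x) y = cinner x z))"

definition normal_op :: "'a::complex_hilbert_space set \<Rightarrow> ('a \<Rightarrow> 'a) \<Rightarrow> bool" where
  "normal_op M T \<longleftrightarrow> bounded_op M T \<and> (\<forall>x\<in>M. T (adj M T x) = adj M T (T x))"

definition reduces :: "'a::complex_hilbert_space set \<Rightarrow> ('a \<Rightarrow> 'a) \<Rightarrow> bool" where
  "reduces M T \<longleftrightarrow> closed_csubspace M \<and> T ` M \<subseteq> M \<and> adj UNIV T ` M \<subseteq> M"

definition commuting_triple ::
  "'a::complex_hilbert_space set \<Rightarrow> ('a \<Rightarrow> 'a) \<Rightarrow> ('a \<Rightarrow> 'a) \<Rightarrow> ('a \<Rightarrow> 'a) \<Rightarrow> bool" where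
  "commuting_triple M A B P \<longleftrightarrow> closed_csubspace M \<and>
     bounded_op M A \<and> bounded_op M B \<and> bounded_op M P \<and>
     (\<forall>x\<in>M. A (B x) = B (A x) \<and> A (P x) = P (A x) \<and> B (P x) = P (B x))"

text \<open>
  Exactness of the Koszul complex \<open>0 \<rightarrow> M \<rightarrow> M\<^sup>3 \<rightarrow> M\<^sup>3 \<rightarrow> M \<rightarrow> 0\<close> of a commuting triple, one
  conjunct for each of the four nonzero terms. The bases of the middle terms are
  \<open>e\<^sub>1, e\<^sub>2, e\<^sub>3\<close> and \<open>e\<^sub>1 \<and> e\<^sub>2, e\<^sub>1 \<and> e\<^sub>3, e\<^sub>2 \<and> e\<^sub>3\<close>.
\<close>

definition koszul0 :: "('a \<Rightarrow> 'a) \<Rightarrow> ('a \<Rightarrow> 'a) \<Rightarrow> ('a \<Rightarrow> 'a) \<Rightarrow> 'a \<Rightarrow> 'a \<times> 'a \<times> 'a" where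
  "koszul0 R S T x = (R x, S x, T x)"

definition koszul1 ::
  "('a::complex_hilbert_space \<Rightarrow> 'a) \<Rightarrow> ('a \<Rightarrow> 'a) \<Rightarrow> ('a \<Rightarrow> 'a) \<Rightarrow> 'a \<times> 'a \<times> 'a \<Rightarrow> 'a \<times> 'a \<times> 'a" where
  "koszul1 R S T = (\<lambda>(x, y, z). (R y - S x, R z - T x, S z - T y))"

definition koszul2 ::
  "('a::complex_hilbert_space \<Rightarrow> 'a) \<Rightarrow> ('a \<Rightarrow> 'a) \<Rightarrow> ('a \<Rightarrow> 'a) \<Rightarrow> 'a \<times> 'a \<times> 'a \<Rightarrow> 'a" where
  "koszul2 R S T = (\<lambda>(u, v, w). R w - S v + T u)"

definition koszul_exact ::
  "'a::complex_hilbert_space set \<Rightarrow> ('a \<Rightarrow> 'a) \<Rightarrow> ('a \<Rightarrow> 'a) \<Rightarrow> ('a \<Rightarrow> 'a) \<Rightarrow> bool" where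
  "koszul_exact M R S T \<longleftrightarrow>
     {x \<in> M. koszul0 R S T x = 0} = {0} \<and>
     {X \<in> M \<times> M \<times> M. koszul1 R S T X = 0} = koszul0 R S T ` M \<and>
     {X \<in> M \<times> M \<times> M. koszul2 R S T X = 0} = koszul1 R S T ` (M \<times> M \<times> M) \<and>
     M = koszul2 R S T ` (M \<times> M \<times> M)"

definition taylor_spectrum ::
  "'a::complex_hilbert_space set \<Rightarrow> ('a \<Rightarrow> 'a) \<Rightarrow> ('a \<Rightarrow> 'a) \<Rightarrow> ('a \<Rightarrow> 'a) \<Rightarrow> (complex \<times> complex \<times> complex) set"
  where
  "taylor_spectrum M A B P =
     {(a, b, p). \<not> koszul_exact M (\<lambda>x. A x - a *\<^sub>C x) (\<lambda>x. B x - b *\<^sub>C x) (\<lambda>x. P x - p *\<^sub>C x)}"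

text \<open>Polynomials in three variables are given by their finitely supported coefficient families.\<close>

type_synonym poly3 = "(nat \<times> nat \<times> nat) \<Rightarrow>\<^sub>0 complex"

definition poly3_eval :: "poly3 \<Rightarrow> complex \<times> complex \<times> complex \<Rightarrow> complex" where
  "poly3_eval f = (\<lambda>(a, b, p).
     \<Sum>(i, j, k)\<in>Poly_Mapping.keys f. Poly_Mapping.lookup f (i, j, k) * (a ^ i * b ^ j * p ^ k))"

definition poly3_op ::
  "poly3 \<Rightarrow> ('a::complex_hilbert_space \<Rightarrow> 'a) \<Rightarrow> ('a \<Rightarrow> 'a) \<Rightarrow> ('a \<Rightarrow> 'a) \<Rightarrow> 'a \<Rightarrow> 'a" where
  "poly3_op f A B P x =
     (\<Sum>(i, j, k)\<in>Poly_Mapping.keys f.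
        Poly_Mapping.lookup f (i, j, k) *\<^sub>C (A ^^ i) ((B ^^ j) ((P ^^ k) x)))"

text \<open>
  The operator \<open>f(A,B,P) g(A,B,P)\<^sup>-\<^sup>1\<close> on \<open>M\<close> for the rational function \<open>f / g\<close>. It is used only
  when \<open>g\<close> has no zero on a set containing the Taylor spectrum, in which case \<open>g(A,B,P)\<close> is
  invertible on \<open>M\<close> by the spectral mapping theorem.
\<close>

definition rat3_op ::
  "'a::complex_hilbert_space set \<Rightarrow> poly3 \<Rightarrow> poly3 \<Rightarrow> ('a \<Rightarrow> 'a) \<Rightarrow> ('a \<Rightarrow> 'a) \<Rightarrow> ('a \<Rightarrow> 'a) \<Rightarrow> 'a \<Rightarrow> 'a" where
  "rat3_op M f g A B P = poly3_op f A B P \<circ> inv_into M (poly3_op g A B P)"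

definition spectral_set ::
  "'a::complex_hilbert_space set \<Rightarrow> (complex \<times> complex \<times> complex) set \<Rightarrow>
    ('a \<Rightarrow> 'a) \<Rightarrow> ('a \<Rightarrow> 'a) \<Rightarrow> ('a \<Rightarrow> 'a) \<Rightarrow> bool" where
  "spectral_set M K A B P \<longleftrightarrow> compact K \<and> taylor_spectrum M A B P \<subseteq> K \<and>
     (\<forall>f g. (\<forall>z\<in>K. poly3_eval g z \<noteq> 0) \<longrightarrow>
        opnorm M (rat3_op M f g A B P) \<le> (SUP z\<in>K. cmod (poly3_eval f z / poly3_eval g z)))"

definition tetrablock :: "(complex \<times> complex \<times> complex) set" where
  "tetrablock = {(x1, x2, x3).
     \<forall>z\<in>cball 0 1. \<forall>w\<in>cball 0 1. 1 - z * x1 - w * x2 + z * w * x3 \<noteq> 0}"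

definition b_tetrablock :: "(complex \<times> complex \<times> complex) set" where
  "b_tetrablock = {(a, b, p). (a, b, p) \<in> closure tetrablock \<and> cmod p = 1}"

definition E_contraction ::
  "'a::complex_hilbert_space set \<Rightarrow> ('a \<Rightarrow> 'a) \<Rightarrow> ('a \<Rightarrow> 'a) \<Rightarrow> ('a \<Rightarrow> 'a) \<Rightarrow> bool" where
  "E_contraction M A B P \<longleftrightarrow>
     commuting_triple M A B P \<and> spectral_set M (closure tetrablock) A B P"

definition E_unitary ::
  "'a::complex_hilbert_space set \<Rightarrow> ('a \<Rightarrow> 'a) \<Rightarrow> ('a \<Rightarrow> 'a) \<Rightarrow> ('a \<Rightarrow> 'a) \<Rightarrow> bool" where
  "E_unitary M A B P \<longleftrightarrow>
     commuting_triple M A B P \<and> normal_op M A \<and> normal_op M B \<and> normal_op M P \<and>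
     taylor_spectrum M A B P \<subseteq> b_tetrablock"

definition weakly_stable :: "'a::complex_hilbert_space set \<Rightarrow> ('a \<Rightarrow> 'a) \<Rightarrow> bool" where
  "weakly_stable M P \<longleftrightarrow> (\<forall>x\<in>M. \<forall>y\<in>M. (\<lambda>k. cinner ((P ^^ k) x) y) \<longlonglongrightarrow> 0)"

definition weakly_stable_E_contraction ::
  "'a::complex_hilbert_space set \<Rightarrow> ('a \<Rightarrow> 'a) \<Rightarrow> ('a \<Rightarrow> 'a) \<Rightarrow> ('a \<Rightarrow> 'a) \<Rightarrow> bool" where
  "weakly_stable_E_contraction M A B P \<longleftrightarrow> E_contraction M A B P \<and> weakly_stable M P"

end

theory Submission
  imports Defs
begin

text \<open>
  Let \<open>N\<close> be the orthogonal complement of \<open>Z\<close>. The proof rests on one pair of inequalities. On the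
  closed tetrablock \<open>\<bar>x\<^sub>2 - z x\<^sub>3\<bar> \<le> \<bar>1 - z x\<^sub>1\<bar>\<close> and \<open>\<bar>x\<^sub>1 - z x\<^sub>3\<bar> \<le> \<bar>1 - z x\<^sub>2\<bar>\<close> for \<open>\<bar>z\<bar> \<le> 1\<close>, so that
  \<open>\<parallel>(B - zP) x\<parallel> \<le> \<parallel>(1 - zA) x\<parallel>\<close> and \<open>\<parallel>(A - zP) x\<parallel> \<le> \<parallel>(1 - zB) x\<parallel>\<close> (\<open>linear_fractional_bound\<close>).
  Adding the squares of these for \<open>z\<close> and \<open>-z\<close> gives \<open>\<parallel>P x\<parallel> \<le> \<parallel>x\<parallel>\<close>, and if \<open>\<parallel>P x\<parallel> = \<parallel>x\<parallel>\<close>, then all of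
  them are equalities. Since a vector on which a nonnegative form vanishes is orthogonal to everything
  for that form, it follows that \<open>A x = B\<^sup>* P x\<close>, \<open>B x = A\<^sup>* P x\<close>, \<open>A\<^sup>* x = P\<^sup>* B x\<close> and \<open>B\<^sup>* x = P\<^sup>* A x\<close>
  (\<open>cinner_A_eq_if_norm_P_eq\<close>).

  Foguel's decomposition is obtained directly. The vectors \<open>(1 - P\<^sup>*P) P\<^sup>*\<^sup>n y\<close> and \<open>(1 - PP\<^sup>*) P\<^sup>*\<^sup>n y\<close>
  tend to zero in norm, whence \<open>Z\<close> contains the ranges of \<open>1 - P\<^sup>*P\<close> and \<open>1 - PP\<^sup>*\<close>
  (\<open>defect_in_weakly_stable_part\<close>). So both operators vanish on \<open>N\<close>, and \<open>Z\<close> reduces \<open>P\<close>.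

  Everything that commutes with \<open>P\<close> preserves \<open>Z\<close>; hence \<open>A\<^sup>*\<close> and \<open>B\<^sup>*\<close> preserve \<open>N\<close>, and
  \<open>A x = B\<^sup>* P x\<close> shows that \<open>A\<close> preserves \<open>N\<close> as well; likewise \<open>B\<close>. On \<open>N\<close> the adjoints
  \<open>A\<^sup>* = P\<^sup>* B\<close>, \<open>B\<^sup>* = P\<^sup>* A\<close>, \<open>P\<^sup>* = P\<^sup>-\<^sup>1\<close> commute with \<open>A\<close>, \<open>B\<close>, \<open>P\<close>, which gives normality. A point outside the
  distinguished boundary is not an approximate joint eigenvalue on \<open>N\<close>, by the inequalities above;
  for such a point \<open>\<Sum> (T\<^sub>i - \<lambda>\<^sub>i)\<^sup>* (T\<^sub>i - \<lambda>\<^sub>i)\<close> is invertible and yields a null-homotopy of the Koszul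
  complex (\<open>E_unitary_if_P_unitary\<close>). On \<open>Z\<close> the Koszul complexes and the rational functional calculus
  are direct summands of those on the whole space (\<open>E_contraction_reducing\<close>).

  The definition of a spectral set bounds \<open>f(A,B,P) g(A,B,P)\<^sup>-\<^sup>1\<close> and is informative only when
  \<open>g(A,B,P)\<close> has a bounded inverse. That it does, whenever \<open>g\<close> has no zero on the closed tetrablock, is proved without
  the spectral mapping theorem, by continuation along \<open>g (t x\<^sub>1, t x\<^sub>2, t\<^sup>2 x\<^sub>3)\<close>
  (\<open>poly3_op_invertible\<close>).
\<close>

section \<open>Complex Hilbert spaces\<close>

interpretation cvs: vector_space "scaleC :: complex \<Rightarrow> 'a::complex_hilbert_space \<Rightarrow> 'a"
proof
  fix a b :: complex and x y :: 'a
  show "a *\<^sub>C (x + y) = a *\<^sub>C x + a *\<^sub>C y" by (rule scaleC_add_right)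
  show "(a + b) *\<^sub>C x = a *\<^sub>C x + b *\<^sub>C x" by (rule scaleC_add_left)
  show "a *\<^sub>C b *\<^sub>C x = (a * b) *\<^sub>C x" by (rule scaleC_scaleC)
  show "1 *\<^sub>C x = x" using scaleR_eq_scaleC[of 1 x] by simp
qed

lemma cinner_add_right: "cinner x (y + z) = cinner x y + cinner x z"
  by (metis cinner_add_left cinner_commute complex_cnj_add)

lemma cinner_scaleC_right: "cinner x (c *\<^sub>C y) = cnj c * cinner x y"
  by (metis cinner_commute cinner_scaleC_left complex_cnj_mult)

lemma cinner_zero [simp]: "cinner 0 x = 0" "cinner x 0 = 0"
  using cinner_add_left[of 0 0 x] cinner_add_right[of x 0 0] by simp_all

lemma cinner_minus_left: "cinner (- x) y = - cinner x y"
  using cinner_add_left[of x "- x" y] by (simp add: eq_neg_iff_add_eq_0 add.commute)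

lemma cinner_minus_right: "cinner x (- y) = - cinner x y"
  using cinner_add_right[of x y "- y"] by (simp add: eq_neg_iff_add_eq_0 add.commute)

lemma cinner_diff_left: "cinner (x - y) z = cinner x z - cinner y z"
  using cinner_add_left[of x "- y" z] by (simp add: cinner_minus_left)

lemma cinner_diff_right: "cinner x (y - z) = cinner x y - cinner x z"
  using cinner_add_right[of x y "- z"] by (simp add: cinner_minus_right)

lemmas cinner_simps = cinner_add_left cinner_add_right cinner_diff_left cinner_diff_right
  cinner_scaleC_left cinner_scaleC_right

lemma cinner_self: "cinner x x = complex_of_real ((norm x)\<^sup>2)"
proof -
  have "Im (cinner x x) = 0"
    using arg_cong[OF cinner_commute[of x x], of Im] by simp
  then show ?thesis
    by (simp add: complex_eq_iff inner_eq_Re_cinner[symmetric] power2_norm_eq_inner)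
qed

lemma norm_sq_cinner: "(norm x)\<^sup>2 = Re (cinner x x)"
  by (simp add: cinner_self)

lemma cinner_eq_zero_commute: "cinner x y = 0 \<longleftrightarrow> cinner y x = 0"
  by (metis cinner_commute complex_cnj_zero)

lemma cinner_ext: "(\<And>y. cinner x y = cinner z y) \<Longrightarrow> x = z"
proof -
  assume "\<And>y. cinner x y = cinner z y"
  then have "cinner (x - z) (x - z) = 0" by (simp add: cinner_diff_left)
  then show ?thesis by (simp add: cinner_self)
qed

lemma norm_scaleC: "norm (c *\<^sub>C x) = cmod c * norm x"
proof -
  have "cinner (c *\<^sub>C x) (c *\<^sub>C x) = (c * cnj c) * cinner x x"
    by (simp add: cinner_simps)
  then have "(norm (c *\<^sub>C x))\<^sup>2 = (cmod c * norm x)\<^sup>2"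
    unfolding norm_sq_cinner[of "c *\<^sub>C x"]
    by (simp add: cinner_self complex_norm_square[symmetric] power_mult_distrib)
  then show ?thesis
    by (simp add: power2_eq_iff_nonneg)
qed

lemma cmod_cinner_le: "cmod (cinner x y) \<le> norm x * norm y"
proof (cases "cinner x y = 0")
  case False
  \<comment> \<open>The unimodular factor that makes the inner product real reduces the claim to the real
    Cauchy-Schwarz inequality.\<close>
  define c where "c = cnj (cinner x y) / cmod (cinner x y)"
  have c: "cmod c = 1" using False by (simp add: c_def norm_divide)
  have "cinner (c *\<^sub>C x) y = complex_of_real (cmod (cinner x y))"
    using False
    by (simp add: cinner_simps c_def field_simps complex_norm_square[symmetric] power2_eq_square
        mult.commute[of "cnj _"])
  then have "cmod (cinner x y) = inner (c *\<^sub>C x) y"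
    by (simp add: inner_eq_Re_cinner)
  also have "\<dots> \<le> norm (c *\<^sub>C x) * norm y"
    by (rule norm_cauchy_schwarz)
  finally show ?thesis by (simp add: norm_scaleC c)
qed simp

lemma bounded_linear_cinner_right: "bounded_linear (\<lambda>x. cinner y x)"
  by (rule bounded_linear_intro[where K = "norm y"])
    (auto simp: cinner_simps scaleR_eq_scaleC scaleC_complex_def cmod_cinner_le
      mult.commute[of "norm _" "norm y"])

lemma norm_diff_scaleC_sq:
  "(norm (u - z *\<^sub>C v))\<^sup>2 = (norm u)\<^sup>2 + (cmod z)\<^sup>2 * (norm v)\<^sup>2 - 2 * Re (z * cinner v u)"
proof -
  have "cinner (u - z *\<^sub>C v) (u - z *\<^sub>C v)
      = cinner u u + (z * cnj z) * cinner v v - (z * cinner v u + cnj (z * cinner v u))"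
    by (simp add: cinner_simps cinner_commute[of u v] algebra_simps)
  then show ?thesis
    unfolding norm_sq_cinner[of "u - z *\<^sub>C v"]
    by (simp add: cinner_self complex_norm_square[symmetric])
qed

section \<open>Orthogonal decomposition and the Riesz representation\<close>

lemma closed_csubspaceD:
  assumes "closed_csubspace M"
  shows "closed M" "0 \<in> M" "x \<in> M \<Longrightarrow> y \<in> M \<Longrightarrow> x + y \<in> M" "x \<in> M \<Longrightarrow> c *\<^sub>C x \<in> M"
    "x \<in> M \<Longrightarrow> - x \<in> M" "x \<in> M \<Longrightarrow> y \<in> M \<Longrightarrow> x - y \<in> M" "x \<in> M \<Longrightarrow> r *\<^sub>R x \<in> M"
proof -
  have c: "\<And>x c. x \<in> M \<Longrightarrow> c *\<^sub>C x \<in> M" and a: "\<And>x y. x \<in> M \<Longrightarrow> y \<in> M \<Longrightarrow> x + y \<in> M"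
    using assms by (auto simp: closed_csubspace_def)
  show "closed M" "0 \<in> M" using assms by (auto simp: closed_csubspace_def)
  show "x \<in> M \<Longrightarrow> y \<in> M \<Longrightarrow> x + y \<in> M" "x \<in> M \<Longrightarrow> c *\<^sub>C x \<in> M" by (auto intro: a c)
  have m: "- x \<in> M" if "x \<in> M" for x using c[OF that, of "-1"] by simp
  then show "x \<in> M \<Longrightarrow> - x \<in> M" .
  show "x \<in> M \<Longrightarrow> y \<in> M \<Longrightarrow> x - y \<in> M" using a[of x "- y"] m by auto
  show "x \<in> M \<Longrightarrow> r *\<^sub>R x \<in> M" by (simp add: scaleR_eq_scaleC c)
qed

lemma closed_csubspace_UNIV [simp]: "closed_csubspace UNIV"
  by (simp add: closed_csubspace_def)

lemma closed_csubspace_ortho_compl: "closed_csubspace (ortho_compl M)"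
proof -
  have "ortho_compl M = (\<Inter>x\<in>M. (\<lambda>y. cinner x y) -` {0})"
    by (auto simp: ortho_compl_def)
  moreover have "closed ((\<lambda>y. cinner x y) -` {0})" for x :: 'a
    by (intro continuous_closed_vimage closed_singleton
        linear_continuous_at bounded_linear_cinner_right)
  ultimately have "closed (ortho_compl M)" by (metis closed_INT)
  then show ?thesis
    by (auto simp: closed_csubspace_def ortho_compl_def cinner_simps)
qed

lemma nearest_point_exists:
  fixes M :: "'a::complex_hilbert_space set"
  assumes M: "closed_csubspace M"
  shows "\<exists>y\<in>M. \<forall>m\<in>M. norm (x - y) \<le> norm (x - m)"
proof -
  define d where "d = (INF m\<in>M. (norm (x - m))\<^sup>2)"
  have d_le: "d \<le> (norm (x - m))\<^sup>2" if "m \<in> M" for m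
    unfolding d_def by (rule cINF_lower) (auto intro!: bdd_belowI[of _ 0] that)
  have "\<exists>m\<in>M. (norm (x - m))\<^sup>2 < d + 1 / Suc n" for n
  proof (rule ccontr)
    assume "\<not> ?thesis"
    then have "\<And>m. m \<in> M \<Longrightarrow> d + 1 / Suc n \<le> (norm (x - m))\<^sup>2" by (auto simp: not_less)
    then have "d + 1 / Suc n \<le> d"
      unfolding d_def using closed_csubspaceD(2)[OF M] by (intro cINF_greatest) auto
    then show False by simp
  qed
  then obtain m where m: "\<And>n. m n \<in> M" "\<And>n. (norm (x - m n))\<^sup>2 < d + 1 / Suc n"
    by metis
  \<comment> \<open>Parallelogram law: two near-minimisers are close because their midpoint is in \<open>M\<close>.\<close>
  have close: "(norm (m i - m j))\<^sup>2 \<le> 2 / Suc i + 2 / Suc j" for i j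
  proof -
    have "(norm ((x - m i) + (x - m j)))\<^sup>2 + (norm ((x - m i) - (x - m j)))\<^sup>2
        = 2 * (norm (x - m i))\<^sup>2 + 2 * (norm (x - m j))\<^sup>2"
      by (simp add: power2_norm_eq_inner inner_simps inner_commute)
    moreover have "(x - m i) + (x - m j) = 2 *\<^sub>R (x - (1/2) *\<^sub>R (m i + m j))"
      by (simp add: algebra_simps scaleR_2)
    then have "(norm ((x - m i) + (x - m j)))\<^sup>2 = 4 * (norm (x - (1/2) *\<^sub>R (m i + m j)))\<^sup>2"
      by (simp add: power2_eq_square)
    moreover have "d \<le> (norm (x - (1/2) *\<^sub>R (m i + m j)))\<^sup>2"
      by (intro d_le closed_csubspaceD(7,3)[OF M] m)
    moreover have "(x - m i) - (x - m j) = - (m i - m j)" by simp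
    then have "norm ((x - m i) - (x - m j)) = norm (m i - m j)" by (metis norm_minus_cancel)
    ultimately show ?thesis using m(2)[of i] m(2)[of j] by auto
  qed
  have "Cauchy m"
  proof (rule metric_CauchyI)
    fix e :: real assume e: "e > 0"
    obtain N :: nat where N: "4 / e\<^sup>2 < N" using reals_Archimedean2 by blast
    have "dist (m i) (m j) < e" if "i \<ge> N" "j \<ge> N" for i j
    proof -
      have "4 / e\<^sup>2 < Suc N" using N by simp
      then have *: "4 / real (Suc N) < e\<^sup>2" using e by (simp add: field_simps)
      have "2 / real (Suc i) \<le> 2 / Suc N" "2 / real (Suc j) \<le> 2 / Suc N"
        using that by (auto intro!: divide_left_mono)
      then have "(norm (m i - m j))\<^sup>2 < e\<^sup>2" using close[of i j] * by linarith
      then show ?thesis using e by (simp add: dist_norm power2_less_imp_less)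
    qed
    then show "\<exists>N. \<forall>i\<ge>N. \<forall>j\<ge>N. dist (m i) (m j) < e" by blast
  qed
  then obtain y where y: "m \<longlonglongrightarrow> y" using Cauchy_convergent convergent_def by blast
  have yM: "y \<in> M" using closed_sequentially[OF closed_csubspaceD(1)[OF M]] m(1) y by blast
  have "(\<lambda>n. (norm (x - m n))\<^sup>2) \<longlonglongrightarrow> (norm (x - y))\<^sup>2" by (intro tendsto_intros y)
  moreover have "(\<lambda>n. d + 1 / Suc n) \<longlonglongrightarrow> d"
    using LIMSEQ_inverse_real_of_nat_add[of d] by (simp add: divide_inverse)
  ultimately have "(norm (x - y))\<^sup>2 \<le> d"
    by (rule LIMSEQ_le) (intro exI[of _ 0] allI impI less_imp_le m(2))
  then have "(norm (x - y))\<^sup>2 \<le> (norm (x - k))\<^sup>2" if "k \<in> M" for k using d_le[OF that]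
    by (rule order_trans)
  then show ?thesis using yM by (metis norm_ge_zero power2_le_imp_le)
qed

lemma orthogonal_decomposition:
  fixes M :: "'a::complex_hilbert_space set"
  assumes M: "closed_csubspace M"
  shows "\<exists>y\<in>M. x - y \<in> ortho_compl M"
proof -
  obtain y where y: "y \<in> M" "\<And>m. m \<in> M \<Longrightarrow> norm (x - y) \<le> norm (x - m)"
    using nearest_point_exists[OF M] by blast
  have "cinner m (x - y) = 0" if m: "m \<in> M" for m
  proof (rule ccontr)
    assume ne: "cinner m (x - y) \<noteq> 0"
    then have m0: "norm m > 0" by auto
    \<comment> \<open>The coefficient for which \<open>y + c m\<close> is the nearest point to \<open>x\<close> on the line through \<open>y\<close> in
      direction \<open>m\<close>.\<close>
    define c where "c = cinner (x - y) m / (norm m)\<^sup>2"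
    have "x - (y + c *\<^sub>C m) = (x - y) - c *\<^sub>C m" by simp
    moreover have "norm (x - y) \<le> norm (x - (y + c *\<^sub>C m))"
      by (intro y closed_csubspaceD(3,4)[OF M] m)
    ultimately have "(norm (x - y))\<^sup>2 \<le> (norm ((x - y) - c *\<^sub>C m))\<^sup>2" by (metis norm_ge_zero power_mono)
    also have "\<dots> = (norm (x - y))\<^sup>2 + (cmod c)\<^sup>2 * (norm m)\<^sup>2 - 2 * Re (c * cinner m (x - y))"
      by (rule norm_diff_scaleC_sq)
    also have "c * cinner m (x - y) = (cmod (cinner (x - y) m))\<^sup>2 / (norm m)\<^sup>2"
      by (simp add: c_def cinner_commute[of m "x - y"] complex_norm_square[symmetric])
    also have "(cmod c)\<^sup>2 * (norm m)\<^sup>2 = (cmod (cinner (x - y) m))\<^sup>2 / (norm m)\<^sup>2"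
      using m0 by (simp add: c_def norm_divide norm_mult power2_eq_square)
    finally have "(cmod (cinner (x - y) m))\<^sup>2 / (norm m)\<^sup>2 \<le> 0" by (simp flip: of_real_power of_real_divide)
    moreover have "(cmod (cinner (x - y) m))\<^sup>2 / (norm m)\<^sup>2 > 0"
      using ne m0 cinner_eq_zero_commute by fastforce
    ultimately show False by simp
  qed
  then show ?thesis using y(1) by (auto simp: ortho_compl_def)
qed

lemma ortho_compl_Int: "x \<in> M \<Longrightarrow> x \<in> ortho_compl M \<Longrightarrow> x = 0"
  by (auto simp: ortho_compl_def cinner_self)

lemma ortho_compl_ortho_compl:
  assumes M: "closed_csubspace M"
  shows "ortho_compl (ortho_compl M) = M"
proof
  show "ortho_compl (ortho_compl M) \<subseteq> M"
  proof
    fix x assume x: "x \<in> ortho_compl (ortho_compl M)"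
    obtain y where y: "y \<in> M" "x - y \<in> ortho_compl M"
      using orthogonal_decomposition[OF M] by blast
    have "cinner (x - y) x = 0" "cinner (x - y) y = 0"
      using x y cinner_eq_zero_commute unfolding ortho_compl_def by blast+
    then have "cinner (x - y) (x - y) = 0" by (simp add: cinner_diff_right)
    then show "x \<in> M" using y by (simp add: cinner_self)
  qed
  show "M \<subseteq> ortho_compl (ortho_compl M)"
    using cinner_eq_zero_commute unfolding ortho_compl_def by blast
qed

lemma riesz_representation:
  fixes \<phi> :: "'a::complex_hilbert_space \<Rightarrow> complex"
  assumes add: "\<And>x y. \<phi> (x + y) = \<phi> x + \<phi> y" and scale: "\<And>c x. \<phi> (c *\<^sub>C x) = c * \<phi> x"
    and bound: "\<And>x. cmod (\<phi> x) \<le> norm x * C"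
  shows "\<exists>z. \<forall>x. \<phi> x = cinner x z"
proof (cases "\<forall>x. \<phi> x = 0")
  case True
  then show ?thesis by (intro exI[of _ 0]) simp
next
  case False
  then obtain x where x: "\<phi> x \<noteq> 0" by blast
  have bl: "bounded_linear \<phi>"
    by (rule bounded_linear_intro[where K = C])
      (auto simp: add scale bound scaleR_eq_scaleC scaleC_complex_def)
  have diff: "\<phi> (u - v) = \<phi> u - \<phi> v" for u v
    by (rule linear_diff[OF bounded_linear.linear[OF bl]])
  define M where "M = {x. \<phi> x = 0}"
  have "M = \<phi> -` {0}" by (auto simp: M_def)
  then have "closed M"
    by (simp add: continuous_closed_vimage linear_continuous_at bl)
  then have M: "closed_csubspace M"
    using diff[of 0 0] by (auto simp: closed_csubspace_def M_def add scale)
  obtain y where y: "y \<in> M" "x - y \<in> ortho_compl M"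
    using orthogonal_decomposition[OF M] by blast
  define v where "v = x - y"
  have v: "\<phi> v \<noteq> 0" using x y by (simp add: v_def diff M_def)
  then have v0: "v \<noteq> 0" using scale[of 0 v] by auto
  \<comment> \<open>The kernel has codimension one, and \<open>v\<close> spans its orthogonal complement.\<close>
  define z where "z = cnj (\<phi> v / (norm v)\<^sup>2) *\<^sub>C v"
  have "\<phi> u = cinner u z" for u
  proof -
    have "u - (\<phi> u / \<phi> v) *\<^sub>C v \<in> M" using v by (simp add: M_def diff scale)
    then have "cinner (u - (\<phi> u / \<phi> v) *\<^sub>C v) v = 0"
      using y by (auto simp: ortho_compl_def v_def)
    then have "cinner u v = (\<phi> u / \<phi> v) * (norm v)\<^sup>2"
      by (simp add: cinner_simps cinner_self)
    then show ?thesis using v v0 by (simp add: z_def cinner_simps)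
  qed
  then show ?thesis by blast
qed

section \<open>Bounded operators, adjoints and coercivity\<close>

lemma bounded_opD:
  assumes M: "closed_csubspace M" and T: "bounded_op M T"
  shows "x \<in> M \<Longrightarrow> T x \<in> M" "x \<in> M \<Longrightarrow> y \<in> M \<Longrightarrow> T (x + y) = T x + T y"
    "x \<in> M \<Longrightarrow> T (c *\<^sub>C x) = c *\<^sub>C T x" "T 0 = 0" "x \<in> M \<Longrightarrow> T (- x) = - T x"
    "x \<in> M \<Longrightarrow> y \<in> M \<Longrightarrow> T (x - y) = T x - T y"
proof -
  have a: "T (x + y) = T x + T y" if "x \<in> M" "y \<in> M" for x y
    using T that by (simp add: bounded_op_def)
  have s: "T (c *\<^sub>C x) = c *\<^sub>C T x" if "x \<in> M" for c x
    using T that by (simp add: bounded_op_def)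
  have m: "T (- x) = - T x" if "x \<in> M" for x using s[OF that, of "-1"] by simp
  show "x \<in> M \<Longrightarrow> T x \<in> M" using T by (auto simp: bounded_op_def)
  show "x \<in> M \<Longrightarrow> y \<in> M \<Longrightarrow> T (x + y) = T x + T y" by (rule a)
  show "x \<in> M \<Longrightarrow> T (c *\<^sub>C x) = c *\<^sub>C T x" by (rule s)
  show "T 0 = 0" using s[OF closed_csubspaceD(2)[OF M], of 0] by simp
  show "x \<in> M \<Longrightarrow> T (- x) = - T x" by (rule m)
  show "x \<in> M \<Longrightarrow> y \<in> M \<Longrightarrow> T (x - y) = T x - T y"
    using a[of x "- y"] m[of y] closed_csubspaceD(5)[OF M, of y] by simp
qed

lemmas bounded_op_UNIVD = bounded_opD(2-6)[OF closed_csubspace_UNIV, simplified]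

lemma bounded_op_bound:
  assumes "bounded_op M T"
  obtains C where "C > 0" "\<And>x. x \<in> M \<Longrightarrow> norm (T x) \<le> C * norm x"
proof -
  obtain C where C: "\<And>x. x \<in> M \<Longrightarrow> norm (T x) \<le> C * norm x"
    using assms unfolding bounded_op_def by blast
  have "norm (T x) \<le> max C 1 * norm x" if "x \<in> M" for x
    using C[OF that] mult_right_mono[of C "max C 1" "norm x"] by simp
  then show ?thesis using that[of "max C 1"] by simp
qed

lemma bounded_opI:
  assumes "\<And>x. x \<in> M \<Longrightarrow> T x \<in> M" "\<And>x y. x \<in> M \<Longrightarrow> y \<in> M \<Longrightarrow> T (x + y) = T x + T y"
    "\<And>c x. x \<in> M \<Longrightarrow> T (c *\<^sub>C x) = c *\<^sub>C T x" "\<And>x. x \<in> M \<Longrightarrow> norm (T x) \<le> C * norm x"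
  shows "bounded_op M T"
  using assms unfolding bounded_op_def by blast

lemma bounded_op_subspace:
  assumes "bounded_op UNIV T" "T ` M \<subseteq> M"
  shows "bounded_op M T"
  using assms by (auto simp: bounded_op_def)

lemma bounded_op_id: "bounded_op M (\<lambda>x. x)"
  by (rule bounded_opI[where C = 1]) auto

lemma bounded_op_comp:
  assumes "bounded_op M S" "bounded_op M T"
  shows "bounded_op M (\<lambda>x. S (T x))"
proof -
  obtain C where C: "C > 0" "\<And>x. x \<in> M \<Longrightarrow> norm (S x) \<le> C * norm x"
    using bounded_op_bound[OF assms(1)] by blast
  obtain D where D: "D > 0" "\<And>x. x \<in> M \<Longrightarrow> norm (T x) \<le> D * norm x"
    using bounded_op_bound[OF assms(2)] by blast
  have T: "T x \<in> M" if "x \<in> M" for x using assms(2) that by (auto simp: bounded_op_def)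
  have "norm (S (T x)) \<le> (C * D) * norm x" if "x \<in> M" for x
    using order_trans[OF C(2)[OF T[OF that]] mult_left_mono[OF D(2)[OF that], of C]] C(1)
    by (simp add: mult.assoc)
  then show ?thesis using assms
    by (intro bounded_opI[where C = "C * D"]) (auto simp: bounded_op_def T)
qed

lemma bounded_op_add:
  assumes M: "closed_csubspace M" and S: "bounded_op M S" and T: "bounded_op M T"
  shows "bounded_op M (\<lambda>x. S x + T x)"
proof -
  obtain C where C: "\<And>x. x \<in> M \<Longrightarrow> norm (S x) \<le> C * norm x"
    using bounded_op_bound[OF S] by blast
  obtain D where D: "\<And>x. x \<in> M \<Longrightarrow> norm (T x) \<le> D * norm x"
    using bounded_op_bound[OF T] by blast
  have "norm (S x + T x) \<le> (C + D) * norm x" if "x \<in> M" for x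
    using norm_triangle_ineq[of "S x" "T x"] C[OF that] D[OF that] by (simp add: distrib_right)
  then show ?thesis
    by (intro bounded_opI[where C = "C + D"])
      (auto simp: bounded_opD[OF M S] bounded_opD[OF M T] closed_csubspaceD[OF M] algebra_simps
        scaleC_add_right)
qed

lemma bounded_op_scaleC:
  assumes M: "closed_csubspace M" and T: "bounded_op M T"
  shows "bounded_op M (\<lambda>x. c *\<^sub>C T x)"
proof -
  obtain D where D: "\<And>x. x \<in> M \<Longrightarrow> norm (T x) \<le> D * norm x"
    using bounded_op_bound[OF T] by blast
  have "norm (c *\<^sub>C T x) \<le> (cmod c * D) * norm x" if "x \<in> M" for x
    using mult_left_mono[OF D[OF that], of "cmod c"] by (simp add: norm_scaleC mult.assoc)
  then show ?thesis
    by (intro bounded_opI[where C = "cmod c * D"])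
      (auto simp: bounded_opD[OF M T] closed_csubspaceD[OF M] scaleC_add_right scaleC_scaleC
        mult.commute[of c])
qed

lemma bounded_op_diff_scaleC:
  assumes M: "closed_csubspace M" and S: "bounded_op M S" and T: "bounded_op M T"
  shows "bounded_op M (\<lambda>x. S x - c *\<^sub>C T x)"
  using bounded_op_add[OF M S bounded_op_scaleC[OF M T, of "- c"]] by simp

lemma bounded_op_funpow: "bounded_op M T \<Longrightarrow> bounded_op M (T ^^ n)"
proof (induction n)
  case 0
  then show ?case using bounded_op_id by (simp add: id_def)
next
  case (Suc n)
  then show ?case using bounded_op_comp[of M T "T ^^ n"] by (simp add: comp_def)
qed

lemma bounded_op_sum:
  assumes M: "closed_csubspace M" and "finite I" "\<And>i. i \<in> I \<Longrightarrow> bounded_op M (T i)"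
  shows "bounded_op M (\<lambda>x. \<Sum>i\<in>I. T i x)"
  using assms(2,3)
proof (induction I rule: finite_induct)
  case empty
  show ?case using closed_csubspaceD[OF M] by (intro bounded_opI[where C = 0]) auto
next
  case (insert i I)
  then show ?case by (simp add: bounded_op_add[OF M])
qed

lemma cinner_adj:
  assumes T: "bounded_op UNIV T"
  shows "cinner (T x) y = cinner x (adj UNIV T y)"
proof -
  obtain C where C: "C > 0" "\<And>x. norm (T x) \<le> C * norm x"
    using bounded_op_bound[OF T] by auto
  have "\<exists>z. \<forall>x. cinner (T x) y = cinner x z"
  proof (rule riesz_representation[where C = "C * norm y"])
    fix x
    show "cmod (cinner (T x) y) \<le> norm x * (C * norm y)"
      using cmod_cinner_le[of "T x" y] mult_right_mono[OF C(2)[of x], of "norm y"]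
      by (simp add: mult.commute mult.left_commute)
  qed (simp_all add: bounded_op_UNIVD[OF T] cinner_simps)
  then have "\<exists>!z. z \<in> UNIV \<and> (\<forall>x\<in>UNIV. cinner (T x) y = cinner x z)"
    by (metis UNIV_I cinner_commute cinner_ext)
  from theI'[OF this] show ?thesis unfolding adj_def by blast
qed

lemma cinner_adj':
  assumes "bounded_op UNIV P"
  shows "cinner (adj UNIV P x) y = cinner x (P y)"
  by (metis cinner_adj[OF assms] cinner_commute)

lemma adj_eqI:
  assumes M: "closed_csubspace M" and z: "z \<in> M" "\<And>x. x \<in> M \<Longrightarrow> cinner (T x) y = cinner x z"
  shows "adj M T y = z"
  unfolding adj_def
proof (rule the_equality)
  show "z \<in> M \<and> (\<forall>x\<in>M. cinner (T x) y = cinner x z)" using z by blast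
  fix w assume w: "w \<in> M \<and> (\<forall>x\<in>M. cinner (T x) y = cinner x w)"
  then have "w - z \<in> M" using z closed_csubspaceD(6)[OF M] by blast
  then have "cinner (w - z) w = cinner (w - z) z" using w z by metis
  then have "cinner (w - z) (w - z) = 0" by (simp add: cinner_diff_right)
  then show "w = z" by (simp add: cinner_self)
qed

lemma norm_adj_le:
  assumes T: "bounded_op UNIV T" and C: "C \<ge> 0" "\<And>x. norm (T x) \<le> C * norm x"
  shows "norm (adj UNIV T y) \<le> C * norm y"
proof (cases "adj UNIV T y = 0")
  case False
  let ?w = "adj UNIV T y"
  have "(norm ?w)\<^sup>2 = Re (cinner (T ?w) y)" by (simp add: cinner_adj[OF T] norm_sq_cinner)
  also have "\<dots> \<le> norm (T ?w) * norm y" using complex_Re_le_cmod cmod_cinner_le order_trans by blast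
  also have "\<dots> \<le> (C * norm ?w) * norm y" by (intro mult_right_mono C) simp
  finally have "norm ?w * norm ?w \<le> norm ?w * (C * norm y)"
    by (simp add: power2_eq_square mult_ac)
  then show ?thesis using False by (simp add: mult_le_cancel_left)
qed (simp add: C)

lemma norm_eq_if_adj_left_inverse:
  assumes T: "bounded_op UNIV T" and x: "adj UNIV T (T x) = x"
  shows "norm (T x) = norm x"
proof -
  have "cinner (T x) (T x) = cinner x x" by (simp add: cinner_adj[OF T] x)
  then show ?thesis by (simp add: cinner_self power2_eq_iff_nonneg flip: of_real_power)
qed

lemma bounded_op_adj:
  assumes T: "bounded_op UNIV T"
  shows "bounded_op UNIV (adj UNIV T)"
proof -
  obtain C where C: "C > 0" "\<And>x. norm (T x) \<le> C * norm x"
    using bounded_op_bound[OF T] by auto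
  show ?thesis
  proof (rule bounded_opI[where C = C])
    fix x y
    show "adj UNIV T (x + y) = adj UNIV T x + adj UNIV T y"
      by (intro adj_eqI) (simp_all add: cinner_simps cinner_adj[OF T])
  next
    fix c x
    show "adj UNIV T (c *\<^sub>C x) = c *\<^sub>C adj UNIV T x"
      by (intro adj_eqI) (simp_all add: cinner_simps cinner_adj[OF T])
  next
    fix y
    show "norm (adj UNIV T y) \<le> C * norm y"
      using C by (intro norm_adj_le[OF T]) auto
  qed simp
qed

text \<open>
  For small \<open>\<tau>\<close> the map \<open>x \<mapsto> x - \<tau> (S x - y)\<close> is a strict contraction, and its fixed point
  solves \<open>S x = y\<close>.
\<close>

lemma lax_milgram:
  fixes M :: "'a::complex_hilbert_space set"
  assumes M: "closed_csubspace M" and S: "bounded_op M S" and c: "c > 0"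
    and coercive: "\<And>x. x \<in> M \<Longrightarrow> c * (norm x)\<^sup>2 \<le> Re (cinner (S x) x)"
  shows "bij_betw S M M"
proof -
  have inj: "inj_on S M"
  proof (rule inj_onI)
    fix x y assume xy: "x \<in> M" "y \<in> M" "S x = S y"
    then have "x - y \<in> M" "S (x - y) = 0"
      by (auto simp: bounded_opD[OF M S] closed_csubspaceD[OF M])
    then have "c * (norm (x - y))\<^sup>2 \<le> 0" using coercive[of "x - y"] by simp
    then show "x = y" using c by (simp add: mult_le_0_iff)
  qed
  obtain L0 where L0: "L0 > 0" "\<And>x. x \<in> M \<Longrightarrow> norm (S x) \<le> L0 * norm x"
    using bounded_op_bound[OF S] by blast
  define L where "L = max L0 c"
  have L: "L > 0" "L \<ge> c" by (auto simp: L_def L0 less_max_iff_disj)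
  have SL: "norm (S x) \<le> L * norm x" if "x \<in> M" for x
    using L0(2)[OF that] mult_right_mono[of L0 L "norm x"] by (simp add: L_def)
  define \<tau> where "\<tau> = c / L\<^sup>2"
  define k where "k = c\<^sup>2 / L\<^sup>2"
  have \<tau>k: "\<tau>\<^sup>2 * L\<^sup>2 = k" "\<tau> * c = k"
    using L by (simp_all add: \<tau>_def k_def power2_eq_square)
  define q where "q = sqrt (1 - k)"
  have cL: "k \<le> 1" "k > 0"
    using L c by (auto simp: k_def power_mono)
  then have q: "0 \<le> q" "q < 1" by (auto simp: q_def)
  have "\<exists>x\<in>M. S x = y" if y: "y \<in> M" for y
  proof -
    define f where "f = (\<lambda>x. x - complex_of_real \<tau> *\<^sub>C (S x - y))"
    have fM: "f ` M \<subseteq> M"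
      using y by (auto simp: f_def bounded_opD[OF M S] closed_csubspaceD[OF M])
    have "dist (f x) (f x') \<le> q * dist x x'" if x: "x \<in> M" "x' \<in> M" for x x'
    proof -
      define w where "w = x - x'"
      have wM: "w \<in> M" using x closed_csubspaceD[OF M] by (simp add: w_def)
      have "f x - f x' = w - complex_of_real \<tau> *\<^sub>C S w"
        using x by (simp add: f_def w_def bounded_opD[OF M S] cvs.scale_right_diff_distrib)
      then have "(dist (f x) (f x'))\<^sup>2 = (norm w)\<^sup>2 + \<tau>\<^sup>2 * (norm (S w))\<^sup>2 - 2 * (\<tau> * Re (cinner (S w) w))"
        by (simp add: dist_norm norm_diff_scaleC_sq)
      also have "\<dots> \<le> (norm w)\<^sup>2 + \<tau>\<^sup>2 * (L * norm w)\<^sup>2 - 2 * (\<tau> * (c * (norm w)\<^sup>2))"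
        using SL[OF wM] coercive[OF wM] c L
        by (intro add_mono diff_mono mult_left_mono power_mono) (auto simp: \<tau>_def)
      also have "\<dots> = (1 + \<tau>\<^sup>2 * L\<^sup>2 - 2 * (\<tau> * c)) * (norm w)\<^sup>2"
        by algebra
      also have "1 + \<tau>\<^sup>2 * L\<^sup>2 - 2 * (\<tau> * c) = 1 - k" by (simp add: \<tau>k)
      also have "(1 - k) * (norm w)\<^sup>2 = (q * dist x x')\<^sup>2"
        using cL by (simp add: q_def w_def dist_norm power_mult_distrib)
      finally show ?thesis by (rule power2_le_imp_le) (simp add: q)
    qed
    moreover have "complete M" by (simp add: complete_eq_closed closed_csubspaceD[OF M])
    moreover have "M \<noteq> {}" using closed_csubspaceD[OF M] by auto
    ultimately obtain x where x: "x \<in> M" "f x = x"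
      using Banach_fix[of M q f] q fM by metis
    then have "complex_of_real \<tau> *\<^sub>C (S x - y) = 0" by (simp add: f_def)
    then have "S x = y" using c L by (auto simp: \<tau>_def)
    then show ?thesis using x by blast
  qed
  then have "S ` M = M" using bounded_opD(1)[OF M S] by blast
  then show ?thesis using inj by (simp add: bij_betw_def)
qed

lemma bounded_op_inv_into:
  assumes M: "closed_csubspace M" and G: "bounded_op M G" and bij: "bij_betw G M M"
    and lower: "\<And>x. x \<in> M \<Longrightarrow> norm x \<le> C * norm (G x)"
  shows "bounded_op M (inv_into M G)"
proof -
  let ?J = "inv_into M G"
  have J: "?J y \<in> M" "G (?J y) = y" if "y \<in> M" for y
    using bij that by (auto simp: bij_betw_def inv_into_into f_inv_into_f)
  have eq: "?J y = x" if "x \<in> M" "y = G x" for x y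
    using bij that by (simp add: bij_betw_def)
  note ops = bounded_opD[OF M G] closed_csubspaceD[OF M] J
  show ?thesis
  proof (rule bounded_opI[where C = C])
    fix x y assume "x \<in> M" "y \<in> M"
    then show "?J (x + y) = ?J x + ?J y" by (intro eq) (simp_all add: ops)
  next
    fix c x assume "x \<in> M"
    then show "?J (c *\<^sub>C x) = c *\<^sub>C ?J x" by (intro eq) (simp_all add: ops)
  next
    fix x assume "x \<in> M"
    then show "norm (?J x) \<le> C * norm x" using lower[of "?J x"] by (simp add: J)
  qed (rule J)
qed

section \<open>Exactness of Koszul complexes\<close>

text \<open>
  If \<open>UR + VS + WT = 1\<close> with \<open>U, V, W\<close> in the commutant of \<open>R, S, T\<close>, then contraction with
  \<open>(U, V, W)\<close> is a null-homotopy of the Koszul complex.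
\<close>

lemma koszul_exact_if_left_inverse:
  fixes M :: "'a::complex_hilbert_space set"
  assumes M: "closed_csubspace M"
    and R: "bounded_op M R" and S: "bounded_op M S" and T: "bounded_op M T"
    and U: "bounded_op M U" and V: "bounded_op M V" and W: "bounded_op M W"
    and comm: "\<And>x. x \<in> M \<Longrightarrow> S (R x) = R (S x)" "\<And>x. x \<in> M \<Longrightarrow> T (R x) = R (T x)"
      "\<And>x. x \<in> M \<Longrightarrow> T (S x) = S (T x)"
    and commU: "\<And>x. x \<in> M \<Longrightarrow> R (U x) = U (R x)" "\<And>x. x \<in> M \<Longrightarrow> S (U x) = U (S x)"
      "\<And>x. x \<in> M \<Longrightarrow> T (U x) = U (T x)"
    and commV: "\<And>x. x \<in> M \<Longrightarrow> R (V x) = V (R x)" "\<And>x. x \<in> M \<Longrightarrow> S (V x) = V (S x)"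
      "\<And>x. x \<in> M \<Longrightarrow> T (V x) = V (T x)"
    and commW: "\<And>x. x \<in> M \<Longrightarrow> R (W x) = W (R x)" "\<And>x. x \<in> M \<Longrightarrow> S (W x) = W (S x)"
      "\<And>x. x \<in> M \<Longrightarrow> T (W x) = W (T x)"
    and inv: "\<And>x. x \<in> M \<Longrightarrow> U (R x) + V (S x) + W (T x) = x"
  shows "koszul_exact M R S T"
proof -
  note lin = bounded_opD[OF M R] bounded_opD[OF M S] bounded_opD[OF M T] bounded_opD[OF M U]
    bounded_opD[OF M V] bounded_opD[OF M W] closed_csubspaceD(2-6)[OF M]
  note ops = lin comm commU commV commW
  have ex0: "{x \<in> M. koszul0 R S T x = 0} = {0}"
  proof -
    have "x = 0" if "x \<in> M" "R x = 0" "S x = 0" "T x = 0" for x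
      using inv[OF that(1)] that by (simp add: lin)
    then show ?thesis by (auto simp: koszul0_def zero_prod_def lin)
  qed
  have ex1: "{X \<in> M \<times> M \<times> M. koszul1 R S T X = 0} = koszul0 R S T ` M"
  proof
    show "koszul0 R S T ` M \<subseteq> {X \<in> M \<times> M \<times> M. koszul1 R S T X = 0}"
      by (auto simp: koszul0_def koszul1_def zero_prod_def ops)
    show "{X \<in> M \<times> M \<times> M. koszul1 R S T X = 0} \<subseteq> koszul0 R S T ` M"
    proof clarify
      fix x y z assume xyz: "x \<in> M" "y \<in> M" "z \<in> M" "koszul1 R S T (x, y, z) = 0"
      then have e: "R y = S x" "R z = T x" "S z = T y"
        by (auto simp: koszul1_def zero_prod_def)
      define v where "v = U x + V y + W z"
      have "R v = x" using xyz(1-3) inv[of x] by (simp add: v_def ops e)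
      moreover have "S v = y" using xyz(1-3) inv[of y] by (simp add: v_def ops flip: e)
      moreover have "T v = z" using xyz(1-3) inv[of z] by (simp add: v_def ops e)
      moreover have "v \<in> M" using xyz(1-3) by (simp add: v_def lin)
      ultimately show "(x, y, z) \<in> koszul0 R S T ` M" by (auto simp: koszul0_def image_iff)
    qed
  qed
  have ex2: "{X \<in> M \<times> M \<times> M. koszul2 R S T X = 0} = koszul1 R S T ` (M \<times> M \<times> M)"
  proof
    show "koszul1 R S T ` (M \<times> M \<times> M) \<subseteq> {X \<in> M \<times> M \<times> M. koszul2 R S T X = 0}"
      by (auto simp: koszul1_def koszul2_def ops)
    show "{X \<in> M \<times> M \<times> M. koszul2 R S T X = 0} \<subseteq> koszul1 R S T ` (M \<times> M \<times> M)"
    proof clarify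
      fix u v w assume m: "u \<in> M" "v \<in> M" "w \<in> M" "koszul2 R S T (u, v, w) = 0"
      then have e: "R w = S v - T u" by (simp add: koszul2_def algebra_simps eq_diff_eq)
      have "R (U u - W w) - S (- (V u + W v)) = u"
        using m(1-3) inv[of u] by (simp add: ops e add_ac)
      moreover have "R (U v + V w) - T (- (V u + W v)) = v"
        using m(1-3) inv[of v] by (simp add: ops e add_ac)
      moreover have "S (U v + V w) - T (U u - W w) = w"
        using m(1-3) inv[of w] by (simp add: ops e algebra_simps)
      moreover have "(- (V u + W v), U u - W w, U v + V w) \<in> M \<times> M \<times> M"
        using m(1-3) by (simp add: lin)
      ultimately show "(u, v, w) \<in> koszul1 R S T ` (M \<times> M \<times> M)"
        by (intro rev_image_eqI[of "(- (V u + W v), U u - W w, U v + V w)"])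
          (simp_all add: koszul1_def)
    qed
  qed
  have ex3: "M = koszul2 R S T ` (M \<times> M \<times> M)"
  proof
    show "koszul2 R S T ` (M \<times> M \<times> M) \<subseteq> M" by (auto simp: koszul2_def lin)
    show "M \<subseteq> koszul2 R S T ` (M \<times> M \<times> M)"
    proof
      fix x assume x: "x \<in> M"
      then have "x = koszul2 R S T (W x, - V x, U x)"
        using inv[of x] by (simp add: koszul2_def ops)
      then show "x \<in> koszul2 R S T ` (M \<times> M \<times> M)"
        using x by (intro rev_image_eqI[of "(W x, - V x, U x)"]) (auto simp: lin)
    qed
  qed
  show ?thesis unfolding koszul_exact_def by (intro conjI ex0 ex1 ex2 ex3)
qed

text \<open>
  When \<open>R, S, T\<close> are jointly bounded below, \<open>R\<^sup>*R + S\<^sup>*S + T\<^sup>*T\<close> is coercive and has an inverse \<open>J\<close>. If moreover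
  the adjoints are in the commutant, then so are \<open>J R\<^sup>*, J S\<^sup>*, J T\<^sup>*\<close>, and they form a left inverse.
\<close>

lemma koszul_exact_if_bounded_below:
  fixes M :: "'a::complex_hilbert_space set"
  assumes M: "closed_csubspace M"
    and R: "bounded_op M R" and S: "bounded_op M S" and T: "bounded_op M T"
    and R': "bounded_op M R'" and S': "bounded_op M S'" and T': "bounded_op M T'"
    and comm: "\<And>x. x \<in> M \<Longrightarrow> S (R x) = R (S x)" "\<And>x. x \<in> M \<Longrightarrow> T (R x) = R (T x)"
      "\<And>x. x \<in> M \<Longrightarrow> T (S x) = S (T x)"
    and commR': "\<And>x. x \<in> M \<Longrightarrow> R (R' x) = R' (R x)" "\<And>x. x \<in> M \<Longrightarrow> S (R' x) = R' (S x)"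
      "\<And>x. x \<in> M \<Longrightarrow> T (R' x) = R' (T x)"
    and commS': "\<And>x. x \<in> M \<Longrightarrow> R (S' x) = S' (R x)" "\<And>x. x \<in> M \<Longrightarrow> S (S' x) = S' (S x)"
      "\<And>x. x \<in> M \<Longrightarrow> T (S' x) = S' (T x)"
    and commT': "\<And>x. x \<in> M \<Longrightarrow> R (T' x) = T' (R x)" "\<And>x. x \<in> M \<Longrightarrow> S (T' x) = T' (S x)"
      "\<And>x. x \<in> M \<Longrightarrow> T (T' x) = T' (T x)"
    and adjoint: "\<And>x y. x \<in> M \<Longrightarrow> y \<in> M \<Longrightarrow> cinner (R' y) x = cinner y (R x)"
      "\<And>x y. x \<in> M \<Longrightarrow> y \<in> M \<Longrightarrow> cinner (S' y) x = cinner y (S x)"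
      "\<And>x y. x \<in> M \<Longrightarrow> y \<in> M \<Longrightarrow> cinner (T' y) x = cinner y (T x)"
    and \<delta>: "\<delta> > 0" "\<And>x. x \<in> M \<Longrightarrow> \<delta> * norm x \<le> norm (R x) + norm (S x) + norm (T x)"
  shows "koszul_exact M R S T"
proof -
  note mem = bounded_opD(1)[OF M R] bounded_opD(1)[OF M S] bounded_opD(1)[OF M T]
    bounded_opD(1)[OF M R'] bounded_opD(1)[OF M S'] bounded_opD(1)[OF M T'] closed_csubspaceD(3)[OF M]
  define D where "D = (\<lambda>x. R' (R x) + S' (S x) + T' (T x))"
  have D: "bounded_op M D"
    unfolding D_def
    by (rule bounded_op_add[OF M bounded_op_add[OF M bounded_op_comp[OF R' R] bounded_op_comp[OF S' S]]
          bounded_op_comp[OF T' T]])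
  have coercive: "\<delta>\<^sup>2 / 3 * (norm x)\<^sup>2 \<le> Re (cinner (D x) x)" if x: "x \<in> M" for x
  proof -
    have sq: "(r + s + t)\<^sup>2 \<le> 3 * (r\<^sup>2 + s\<^sup>2 + t\<^sup>2)" for r s t :: real
    proof -
      have "3 * (r\<^sup>2 + s\<^sup>2 + t\<^sup>2) - (r + s + t)\<^sup>2 = (r - s)\<^sup>2 + (s - t)\<^sup>2 + (r - t)\<^sup>2" by algebra
      moreover have "0 \<le> (r - s)\<^sup>2 + (s - t)\<^sup>2 + (r - t)\<^sup>2" by simp
      ultimately show ?thesis by linarith
    qed
    have "(\<delta> * norm x)\<^sup>2 \<le> (norm (R x) + norm (S x) + norm (T x))\<^sup>2"
      using \<delta> x by (intro power_mono) auto
    also have "\<dots> \<le> 3 * ((norm (R x))\<^sup>2 + (norm (S x))\<^sup>2 + (norm (T x))\<^sup>2)" by (rule sq)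
    also have "(norm (R x))\<^sup>2 + (norm (S x))\<^sup>2 + (norm (T x))\<^sup>2 = Re (cinner (D x) x)"
      using x by (simp add: D_def cinner_add_left adjoint mem cinner_self)
    finally show ?thesis by (simp add: power_mult_distrib)
  qed
  have \<delta>3: "\<delta>\<^sup>2 / 3 > 0" using \<delta> by simp
  have bij: "bij_betw D M M" by (rule lax_milgram[OF M D \<delta>3 coercive])
  define J where "J = inv_into M D"
  have "norm x \<le> 1 / (\<delta>\<^sup>2 / 3) * norm (D x)" if x: "x \<in> M" for x
  proof (cases "x = 0")
    case False
    have "\<delta>\<^sup>2 / 3 * (norm x)\<^sup>2 \<le> norm (D x) * norm x"
      using coercive[OF x] complex_Re_le_cmod[of "cinner (D x) x"] cmod_cinner_le[of "D x" x] by linarith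
    then have "\<delta>\<^sup>2 / 3 * norm x \<le> norm (D x)" using False by (simp add: power2_eq_square)
    then show ?thesis using \<delta> by (simp add: field_simps)
  qed simp
  then have J: "bounded_op M J"
    unfolding J_def by (rule bounded_op_inv_into[OF M D bij])
  have DJ: "J y \<in> M" "D (J y) = y" "J (D y) = y" if "y \<in> M" for y
    using that bij
    by (auto simp: J_def bij_betw_def inv_into_into f_inv_into_f)
  note lin = bounded_opD(2)[OF M R] bounded_opD(2)[OF M S] bounded_opD(2)[OF M T]
  have J_comm: "X (J x) = J (X x)"
    if X: "X \<in> {R, S, T}" and x: "x \<in> M" for X x
  proof -
    have "D (X (J x)) = X (D (J x))"
      using X DJ(1)[OF x] by (auto simp: D_def lin mem comm commR' commS' commT')
    then have "J (D (X (J x))) = J (X x)" using DJ x by simp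
    moreover have "X (J x) \<in> M" using X DJ(1)[OF x] mem by auto
    ultimately show ?thesis using DJ(3) by simp
  qed
  show ?thesis
  proof (rule koszul_exact_if_left_inverse[OF M R S T])
    show "bounded_op M (\<lambda>x. J (R' x))" "bounded_op M (\<lambda>x. J (S' x))" "bounded_op M (\<lambda>x. J (T' x))"
      by (rule bounded_op_comp[OF J R'], rule bounded_op_comp[OF J S'], rule bounded_op_comp[OF J T'])
    show "J (R' (R x)) + J (S' (S x)) + J (T' (T x)) = x" if "x \<in> M" for x
      using DJ(3)[OF that] that by (simp add: D_def bounded_opD(2)[OF M J] mem)
  qed (simp_all add: comm J_comm mem commR' commS' commT')
qed

text \<open>A projection \<open>Q\<close> that commutes with \<open>R, S, T\<close> maps the Koszul complex of the whole space onto that of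
  \<open>M\<close>, which is therefore a direct summand.\<close>

lemma koszul_exact_retract:
  fixes M :: "'a::complex_hilbert_space set"
  assumes M: "closed_csubspace M" and exact: "koszul_exact UNIV R S T"
    and Q: "bounded_op UNIV Q" "\<And>x. Q x \<in> M" "\<And>x. x \<in> M \<Longrightarrow> Q x = x"
    and comm: "\<And>x. Q (R x) = R (Q x)" "\<And>x. Q (S x) = S (Q x)" "\<And>x. Q (T x) = T (Q x)"
  shows "koszul_exact M R S T"
proof -
  note ops = bounded_op_UNIVD[OF Q(1)] comm
  have mem: "R x \<in> M" "S x \<in> M" "T x \<in> M" if "x \<in> M" for x
    using Q comm that by metis+
  note cl = closed_csubspaceD(2-6)[OF M]
  have ex0: "{x. koszul0 R S T x = 0} = {0}"
    and ex1: "{X. koszul1 R S T X = 0} = range (koszul0 R S T)"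
    and ex2: "{X. koszul2 R S T X = 0} = range (koszul1 R S T)"
    and ex3: "range (koszul2 R S T) = UNIV"
    using exact by (simp_all add: koszul_exact_def)
  have 0: "{x \<in> M. koszul0 R S T x = 0} = {0}" using ex0 cl by blast
  have 1: "{X \<in> M \<times> M \<times> M. koszul1 R S T X = 0} = koszul0 R S T ` M"
  proof
    show "koszul0 R S T ` M \<subseteq> {X \<in> M \<times> M \<times> M. koszul1 R S T X = 0}"
    proof -
      have "koszul1 R S T (koszul0 R S T v) = 0" for v using ex1 by blast
      then show ?thesis using mem by (auto simp: koszul0_def)
    qed
    show "{X \<in> M \<times> M \<times> M. koszul1 R S T X = 0} \<subseteq> koszul0 R S T ` M"
    proof clarify
      fix x y z assume xyz: "x \<in> M" "y \<in> M" "z \<in> M" "koszul1 R S T (x, y, z) = 0"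
      then obtain v where v: "(x, y, z) = koszul0 R S T v" using ex1 by blast
      then have "(Q x, Q y, Q z) = koszul0 R S T (Q v)"
        by (simp add: koszul0_def ops)
      then have "(x, y, z) = koszul0 R S T (Q v)"
        using xyz Q(3) by simp
      then show "(x, y, z) \<in> koszul0 R S T ` M" using Q(2) by blast
    qed
  qed
  have 2: "{X \<in> M \<times> M \<times> M. koszul2 R S T X = 0} = koszul1 R S T ` (M \<times> M \<times> M)"
  proof
    show "koszul1 R S T ` (M \<times> M \<times> M) \<subseteq> {X \<in> M \<times> M \<times> M. koszul2 R S T X = 0}"
    proof -
      have "koszul2 R S T (koszul1 R S T X) = 0" for X using ex2 by blast
      then show ?thesis using mem cl by (auto simp: koszul1_def)
    qed
    show "{X \<in> M \<times> M \<times> M. koszul2 R S T X = 0} \<subseteq> koszul1 R S T ` (M \<times> M \<times> M)"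
    proof clarify
      fix u v w assume m: "u \<in> M" "v \<in> M" "w \<in> M" "koszul2 R S T (u, v, w) = 0"
      then obtain x y z where v: "(u, v, w) = koszul1 R S T (x, y, z)" using ex2 by fast
      then have uvw: "u = R y - S x" "v = R z - T x" "w = S z - T y" by (auto simp: koszul1_def)
      have "Q u = R (Q y) - S (Q x)" "Q v = R (Q z) - T (Q x)" "Q w = S (Q z) - T (Q y)"
        unfolding uvw by (simp_all add: ops)
      then have "(u, v, w) = koszul1 R S T (Q x, Q y, Q z)"
        using m Q(3) by (simp add: koszul1_def)
      then show "(u, v, w) \<in> koszul1 R S T ` (M \<times> M \<times> M)" using Q(2) by blast
    qed
  qed
  have 3: "M = koszul2 R S T ` (M \<times> M \<times> M)"
  proof
    show "koszul2 R S T ` (M \<times> M \<times> M) \<subseteq> M" using mem cl by (auto simp: koszul2_def)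
    show "M \<subseteq> koszul2 R S T ` (M \<times> M \<times> M)"
    proof
      fix x assume x: "x \<in> M"
      obtain u v w where v: "x = koszul2 R S T (u, v, w)" using ex3 by (metis UNIV_I imageE prod_cases3)
      have "Q x = koszul2 R S T (Q u, Q v, Q w)"
        unfolding v by (simp add: koszul2_def ops)
      then have "x = koszul2 R S T (Q u, Q v, Q w)" using Q(3)[OF x] by simp
      then show "x \<in> koszul2 R S T ` (M \<times> M \<times> M)" using Q(2) by blast
    qed
  qed
  show ?thesis unfolding koszul_exact_def by (intro conjI 0 1 2 3)
qed

section \<open>The tetrablock\<close>

lemma tetrablock_iff:
  "(a, b, p) \<in> tetrablock \<longleftrightarrow>
    (\<forall>z w. cmod z \<le> 1 \<longrightarrow> cmod w \<le> 1 \<longrightarrow> 1 - z * a - w * b + z * w * p \<noteq> 0)"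
  by (auto simp: tetrablock_def)

text \<open>
  For fixed \<open>z\<close>, the equation \<open>1 - z a = w (b - z p)\<close> has a solution \<open>w\<close> in the closed disc as soon as
  \<open>\<bar>1 - z a\<bar> \<le> \<bar>b - z p\<bar> \<noteq> 0\<close>.
\<close>

lemma tetrablock_bounds:
  assumes "(a, b, p) \<in> tetrablock"
  shows "cmod a \<le> 1" "cmod z \<le> 1 \<Longrightarrow> cmod (b - z * p) \<le> cmod (1 - z * a)"
proof -
  have nz: "1 - z * a - w * b + z * w * p \<noteq> 0" if "cmod z \<le> 1" "cmod w \<le> 1" for z w
    using assms that by (simp add: tetrablock_iff)
  show "cmod a \<le> 1"
  proof (rule ccontr)
    assume "\<not> cmod a \<le> 1"
    then show False using nz[of "1 / a" 0] by (cases "a = 0") (auto simp: norm_divide field_simps)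
  qed
  show "cmod (b - z * p) \<le> cmod (1 - z * a)" if z: "cmod z \<le> 1"
  proof (rule ccontr)
    assume less: "\<not> ?thesis"
    define w where "w = (1 - z * a) / (b - z * p)"
    have "cmod w \<le> 1" using less by (simp add: w_def norm_divide divide_le_eq_1)
    moreover have "w * (b - z * p) = 1 - z * a" using less by (auto simp: w_def)
    then have "1 - z * a - w * b + z * w * p = 0" by algebra
    ultimately show False using nz z by blast
  qed
qed

text \<open>
  The inequality passes to limits. Conversely, a point that satisfies it is the limit of
  \<open>(r a, r b, r\<^sup>2 p)\<close> as \<open>r \<rightarrow> 1\<close>; for \<open>r < 1\<close> these points lie in the tetrablock, because the scaling replaces
  \<open>z\<close>, \<open>w\<close> by \<open>r z\<close>, \<open>r w\<close> in the open disc, where \<open>\<bar>w (b - z p)\<bar> < \<bar>1 - z a\<bar>\<close>.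
\<close>

lemma closure_tetrablock_iff:
  "(a, b, p) \<in> closure tetrablock \<longleftrightarrow>
    cmod a \<le> 1 \<and> (\<forall>z. cmod z \<le> 1 \<longrightarrow> cmod (b - z * p) \<le> cmod (1 - z * a))"
proof (intro iffI conjI allI impI)
  assume abp: "(a, b, p) \<in> closure tetrablock"
  have "closure tetrablock \<subseteq> {x. cmod (fst x) \<le> 1}"
    by (intro closure_minimal closed_Collect_le continuous_intros) (auto dest: tetrablock_bounds)
  with abp show "cmod a \<le> 1" by auto
  fix z :: complex assume z: "cmod z \<le> 1"
  have "closure tetrablock \<subseteq> {x. cmod (fst (snd x) - z * snd (snd x)) \<le> cmod (1 - z * fst x)}"
    by (intro closure_minimal closed_Collect_le continuous_intros)
      (auto intro: tetrablock_bounds z)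
  with abp show "cmod (b - z * p) \<le> cmod (1 - z * a)" by auto
next
  assume *: "cmod a \<le> 1 \<and> (\<forall>z. cmod z \<le> 1 \<longrightarrow> cmod (b - z * p) \<le> cmod (1 - z * a))"
  define r where "r = (\<lambda>n. complex_of_real (1 - inverse (real (Suc n))))"
  have r: "cmod (r n) < 1" for n
    unfolding r_def norm_of_real by (simp add: field_simps)
  have "(r n * a, r n * b, (r n)\<^sup>2 * p) \<in> tetrablock" for n
    unfolding tetrablock_iff
  proof (intro allI impI notI)
    fix z w :: complex
    assume zw: "cmod z \<le> 1" "cmod w \<le> 1"
      and 0: "1 - z * (r n * a) - w * (r n * b) + z * w * ((r n)\<^sup>2 * p) = 0"
    define z' w' where "z' = r n * z" and "w' = r n * w"
    have le: "cmod (r n) * cmod u < 1" if "cmod u \<le> 1" for u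
      using mult_left_mono[OF that, of "cmod (r n)"] r[of n] by simp
    have z': "cmod z' < 1" "cmod w' < 1" using le zw by (simp_all add: z'_def w'_def norm_mult)
    have "cmod (z' * a) < 1"
      using mult_left_mono[of "cmod a" 1 "cmod z'"] z' * by (simp add: norm_mult)
    then have pos: "cmod (1 - z' * a) > 0" by auto
    have "w' * (b - z' * p) = 1 - z' * a" using 0 by (simp add: z'_def w'_def algebra_simps power2_eq_square)
    then have "cmod (1 - z' * a) = cmod w' * cmod (b - z' * p)" by (metis norm_mult)
    also have "\<dots> \<le> cmod w' * cmod (1 - z' * a)" using * z' by (intro mult_left_mono) auto
    also have "\<dots> < cmod (1 - z' * a)" using z' pos by simp
    finally show False by simp
  qed
  then have mem: "(r n * a, r n * b, (r n)\<^sup>2 * p) \<in> closure tetrablock" for n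
    using closure_subset by blast
  have "r \<longlonglongrightarrow> complex_of_real 1"
    unfolding r_def
    by (intro tendsto_of_real) (use LIMSEQ_inverse_real_of_nat_add_minus[of 1] in simp)
  then have "(\<lambda>n. (r n * a, r n * b, (r n)\<^sup>2 * p)) \<longlonglongrightarrow> (1 * a, 1 * b, 1\<^sup>2 * p)"
    by (intro tendsto_intros) simp_all
  then show "(a, b, p) \<in> closure tetrablock"
    using closed_sequentially[OF closed_closure] mem by fastforce
qed

lemma closure_tetrablock_swap:
  assumes "(a, b, p) \<in> closure tetrablock"
  shows "(b, a, p) \<in> closure tetrablock"
proof -
  let ?f = "\<lambda>x :: complex \<times> complex \<times> complex. (fst (snd x), fst x, snd (snd x))"
  have "?f x \<in> tetrablock" if "x \<in> tetrablock" for x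
  proof -
    obtain a b p where x: "x = (a, b, p)" by (cases x)
    have "1 - z * b - w * a + z * w * p \<noteq> 0" if "cmod z \<le> 1" "cmod w \<le> 1" for z w
      using \<open>x \<in> tetrablock\<close>[unfolded x tetrablock_iff, rule_format, of w z] that
      by (simp add: algebra_simps)
    then show ?thesis by (simp add: x tetrablock_iff)
  qed
  then have "?f ` closure tetrablock \<subseteq> closure tetrablock"
    by (intro image_closure_subset continuous_intros closed_closure)
      (use closure_subset in blast)
  from subsetD[OF this imageI[OF assms]] show ?thesis by simp
qed

text \<open>
  In the defining condition, scaling with weights \<open>(1, 1, 2)\<close> amounts to replacing \<open>z\<close>, \<open>w\<close> by
  \<open>t z\<close>, \<open>t w\<close>.
\<close>

lemma closure_tetrablock_scale:
  assumes "(a, b, p) \<in> closure tetrablock" and t: "cmod t \<le> 1"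
  shows "(t * a, t * b, t\<^sup>2 * p) \<in> closure tetrablock"
proof -
  let ?f = "\<lambda>x :: complex \<times> complex \<times> complex. (t * fst x, t * fst (snd x), t\<^sup>2 * snd (snd x))"
  have "?f x \<in> tetrablock" if "x \<in> tetrablock" for x
  proof -
    obtain a b p where x: "x = (a, b, p)" by (cases x)
    have "1 - z * (t * a) - w * (t * b) + z * w * (t\<^sup>2 * p) \<noteq> 0"
      if "cmod z \<le> 1" "cmod w \<le> 1" for z w
    proof -
      have "cmod (z * t) \<le> 1" "cmod (w * t) \<le> 1"
        using that t by (auto simp: norm_mult intro: mult_le_one)
      from \<open>x \<in> tetrablock\<close>[unfolded x tetrablock_iff, rule_format, OF this]
      show ?thesis by (simp add: power2_eq_square mult_ac)
    qed
    then show ?thesis by (simp add: x tetrablock_iff)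
  qed
  then have "?f ` closure tetrablock \<subseteq> closure tetrablock"
    by (intro image_closure_subset continuous_intros closed_closure)
      (use closure_subset in blast)
  from subsetD[OF this imageI[OF assms(1)]] show ?thesis by simp
qed

lemma zero_in_tetrablock: "(0, 0, 0) \<in> tetrablock"
  by (simp add: tetrablock_iff)

section \<open>Polynomials in a commuting triple\<close>

lemma poly3_eval_superset:
  assumes "finite S" "Poly_Mapping.keys f \<subseteq> S"
  shows "poly3_eval f (a, b, p) =
    (\<Sum>(i, j, k)\<in>S. Poly_Mapping.lookup f (i, j, k) * (a ^ i * b ^ j * p ^ k))"
  unfolding poly3_eval_def prod.case using assms
  by (intro sum.mono_neutral_left) (auto simp: in_keys_iff)

lemma poly3_op_superset:
  assumes "finite S" "Poly_Mapping.keys f \<subseteq> S"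
  shows "poly3_op f A B P x =
    (\<Sum>(i, j, k)\<in>S. Poly_Mapping.lookup f (i, j, k) *\<^sub>C (A ^^ i) ((B ^^ j) ((P ^^ k) x)))"
  unfolding poly3_op_def using assms
  by (intro sum.mono_neutral_left) (auto simp: in_keys_iff)

lemma poly3_eval_add:
  "poly3_eval (f + g) (a, b, p) = poly3_eval f (a, b, p) + poly3_eval g (a, b, p)"
proof -
  let ?S = "Poly_Mapping.keys f \<union> Poly_Mapping.keys g"
  have "poly3_eval h (a, b, p) =
      (\<Sum>(i, j, k)\<in>?S. Poly_Mapping.lookup h (i, j, k) * (a ^ i * b ^ j * p ^ k))"
    if "h \<in> {f, g, f + g}" for h
    using that keys_add[of f g] by (intro poly3_eval_superset) auto
  then show ?thesis
    by (simp add: sum.distrib[symmetric] lookup_add distrib_right case_prod_beta')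
qed

lemma poly3_op_add:
  "poly3_op (f + g) A B P x = poly3_op f A B P x + poly3_op g A B P x"
proof -
  let ?S = "Poly_Mapping.keys f \<union> Poly_Mapping.keys g"
  have "poly3_op h A B P x =
      (\<Sum>(i, j, k)\<in>?S. Poly_Mapping.lookup h (i, j, k) *\<^sub>C (A ^^ i) ((B ^^ j) ((P ^^ k) x)))"
    if "h \<in> {f, g, f + g}" for h
    using that keys_add[of f g] by (intro poly3_op_superset) auto
  then show ?thesis
    by (simp add: sum.distrib[symmetric] lookup_add scaleC_add_left case_prod_beta')
qed

lemma poly3_eval_single:
  "poly3_eval (Poly_Mapping.single (i, j, k) c) (a, b, p) = c * (a ^ i * b ^ j * p ^ k)"
  by (subst poly3_eval_superset[of "{(i, j, k)}"]) auto

lemma poly3_op_single: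
  "poly3_op (Poly_Mapping.single (i, j, k) c) A B P x = c *\<^sub>C (A ^^ i) ((B ^^ j) ((P ^^ k) x))"
  by (subst poly3_op_superset[of "{(i, j, k)}"]) auto

lemmas poly3_simps = poly3_eval_add poly3_eval_single poly3_op_add poly3_op_single

lemma continuous_on_poly3_eval: "continuous_on S (poly3_eval f)"
  unfolding poly3_eval_def case_prod_beta' by (intro continuous_intros)

lemma bounded_op_monomial:
  assumes "bounded_op M A" "bounded_op M B" "bounded_op M P"
  shows "bounded_op M (\<lambda>x. (A ^^ i) ((B ^^ j) ((P ^^ k) x)))"
  by (rule bounded_op_comp[of M "A ^^ i" "\<lambda>x. (B ^^ j) ((P ^^ k) x)"],
      rule bounded_op_funpow[OF assms(1)], rule bounded_op_comp;
      rule bounded_op_funpow; rule assms)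

lemma bounded_op_poly3_op:
  assumes M: "closed_csubspace M" and "bounded_op M A" "bounded_op M B" "bounded_op M P"
  shows "bounded_op M (poly3_op f A B P)"
proof -
  have "poly3_op f A B P = (\<lambda>x. \<Sum>l\<in>Poly_Mapping.keys f. Poly_Mapping.lookup f l *\<^sub>C
      (A ^^ fst l) ((B ^^ fst (snd l)) ((P ^^ snd (snd l)) x)))"
    by (simp add: poly3_op_def fun_eq_iff case_prod_beta')
  then show ?thesis
    using bounded_op_sum[OF M finite_keys, of f] bounded_op_scaleC[OF M]
      bounded_op_monomial[OF assms(2-4)] by simp
qed

lemma poly3_op_commute:
  assumes Q: "bounded_op UNIV Q"
    and comm: "\<And>x. Q (A x) = A (Q x)" "\<And>x. Q (B x) = B (Q x)" "\<And>x. Q (P x) = P (Q x)"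
  shows "Q (poly3_op f A B P x) = poly3_op f A B P (Q x)"
proof -
  have pow: "Q ((T ^^ n) y) = (T ^^ n) (Q y)" if "\<And>x. Q (T x) = T (Q x)" for T n y
    using that by (induction n) auto
  have "Q (\<Sum>l\<in>I. h l) = (\<Sum>l\<in>I. Q (h l))" if "finite I" for I :: "(nat \<times> nat \<times> nat) set" and h
    using that by induction (simp_all add: bounded_op_UNIVD[OF Q])
  then show ?thesis
    by (simp add: poly3_op_def case_prod_beta' bounded_op_UNIVD[OF Q] pow comm)
qed

text \<open>The polynomial \<open>g (t x\<^sub>1, t x\<^sub>2, t\<^sup>2 x\<^sub>3)\<close>.\<close>

definition weighted_scale :: "complex \<Rightarrow> poly3 \<Rightarrow> poly3" where
  "weighted_scale t g = Poly_Mapping.mapp (\<lambda>(i, j, k) c. t ^ (i + j + 2 * k) * c) g"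

lemma weighted_scale:
  shows keys_weighted_scale: "Poly_Mapping.keys (weighted_scale t g) \<subseteq> Poly_Mapping.keys g"
    and lookup_weighted_scale: "Poly_Mapping.lookup (weighted_scale t g) (i, j, k)
      = t ^ (i + j + 2 * k) * Poly_Mapping.lookup g (i, j, k)"
  by (auto simp: weighted_scale_def keys_mapp_subset lookup_mapp when_def in_keys_iff)

lemma poly3_eval_weighted_scale:
  "poly3_eval (weighted_scale t g) (a, b, p) = poly3_eval g (t * a, t * b, t\<^sup>2 * p)"
proof -
  have "poly3_eval (weighted_scale t g) (a, b, p) = (\<Sum>(i, j, k)\<in>Poly_Mapping.keys g.
      Poly_Mapping.lookup (weighted_scale t g) (i, j, k) * (a ^ i * b ^ j * p ^ k))"
    by (rule poly3_eval_superset[OF finite_keys keys_weighted_scale])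
  also have "\<dots> = (\<Sum>(i, j, k)\<in>Poly_Mapping.keys g.
      Poly_Mapping.lookup g (i, j, k) * ((t * a) ^ i * (t * b) ^ j * (t\<^sup>2 * p) ^ k))"
    unfolding lookup_weighted_scale power_mult_distrib power_add power_mult
    by (intro sum.cong) (auto simp: mult_ac)
  finally show ?thesis by (simp add: poly3_eval_def)
qed

lemma poly3_op_weighted_scale:
  "poly3_op (weighted_scale t g) A B P x = (\<Sum>(i, j, k)\<in>Poly_Mapping.keys g.
    (t ^ (i + j + 2 * k) * Poly_Mapping.lookup g (i, j, k)) *\<^sub>C (A ^^ i) ((B ^^ j) ((P ^^ k) x)))"
  unfolding poly3_op_superset[OF finite_keys keys_weighted_scale] lookup_weighted_scale ..

lemma poly3_op_weighted_scale_Lipschitz: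
  fixes A B P :: "'a::complex_hilbert_space \<Rightarrow> 'a"
  assumes "bounded_op UNIV A" "bounded_op UNIV B" "bounded_op UNIV P"
  obtains L where "L > 0" "\<And>s t x. cmod s \<le> 1 \<Longrightarrow> cmod t \<le> 1 \<Longrightarrow>
    norm (poly3_op (weighted_scale s g) A B P x - poly3_op (weighted_scale t g) A B P x)
      \<le> L * cmod (s - t) * norm x"
proof -
  let ?K = "Poly_Mapping.keys g"
  let ?T = "\<lambda>(i, j, k) x. (A ^^ i) ((B ^^ j) ((P ^^ k) x))"
  let ?w = "\<lambda>(i, j, k). i + j + 2 * k :: nat"
  have T: "bounded_op UNIV (?T l)" for l
    by (cases l) (simp add: bounded_op_monomial[OF assms])
  have bound: "\<exists>C>0. \<forall>x. norm (S x) \<le> C * norm x" if "bounded_op UNIV S" for S :: "'a \<Rightarrow> 'a"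
    by (rule bounded_op_bound[OF that]) auto
  have "\<forall>l. \<exists>C>0. \<forall>x. norm (?T l x) \<le> C * norm x"
    using bound[OF T] by blast
  then obtain C where C: "\<And>l. C l > 0" "\<And>l x. norm (?T l x) \<le> C l * norm x" by metis
  \<comment> \<open>The summand \<open>1\<close> only serves to make \<open>L\<close> positive.\<close>
  define L where "L = 1 + (\<Sum>l\<in>?K. real (?w l) * cmod (Poly_Mapping.lookup g l) * C l)"
  have "L > 0" unfolding L_def
    using C(1) by (intro add_pos_nonneg sum_nonneg mult_nonneg_nonneg) (auto intro: less_imp_le)
  moreover have "norm (poly3_op (weighted_scale s g) A B P x - poly3_op (weighted_scale t g) A B P x)
      \<le> L * cmod (s - t) * norm x" if s: "cmod s \<le> 1" and t: "cmod t \<le> 1" for s t x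
  proof -
    have "poly3_op (weighted_scale s g) A B P x - poly3_op (weighted_scale t g) A B P x
        = (\<Sum>l\<in>?K. ((s ^ ?w l - t ^ ?w l) * Poly_Mapping.lookup g l) *\<^sub>C ?T l x)"
      by (simp add: poly3_op_weighted_scale case_prod_beta' left_diff_distrib
          cvs.scale_left_diff_distrib flip: sum_subtractf)
    also have "norm \<dots> \<le> (\<Sum>l\<in>?K. (real (?w l) * cmod (s - t) * cmod (Poly_Mapping.lookup g l))
        * (C l * norm x))"
      by (intro sum_norm_le)
        (auto simp: norm_scaleC norm_mult intro!: mult_mono norm_power_diff[OF s t] C(2)[of "(_, _, _)", simplified] mult_nonneg_nonneg)
    also have "\<dots> = (\<Sum>l\<in>?K. real (?w l) * cmod (Poly_Mapping.lookup g l) * C l)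
        * (cmod (s - t) * norm x)"
      by (simp add: sum_distrib_left sum_distrib_right mult_ac)
    also have "\<dots> \<le> L * (cmod (s - t) * norm x)"
      by (intro mult_right_mono) (simp_all add: L_def)
    finally show ?thesis by (simp add: mult.assoc)
  qed
  ultimately show ?thesis using that by blast
qed

section \<open>The rational functional calculus of a tetrablock contraction\<close>

text \<open>\<open>G\<^sup>-\<^sup>1 G'\<close> differs from the identity by at most \<open>1/2\<close> in norm and is therefore coercive.\<close>

lemma invertible_perturbation:
  fixes G G' :: "'a::complex_hilbert_space \<Rightarrow> 'a"
  assumes G: "bounded_op UNIV G" "bij G" "\<And>x. norm x \<le> C * norm (G x)" and C: "C \<ge> 0"
    and G': "bounded_op UNIV G'" and close: "\<And>x. norm (G' x - G x) \<le> \<epsilon> * norm x"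
    and small: "C * \<epsilon> \<le> 1 / 2"
  shows "bij G'" "norm x \<le> 2 * C * norm (G' x)"
proof -
  define J where "J = inv G"
  have J: "bounded_op UNIV J"
    unfolding J_def by (rule bounded_op_inv_into[OF closed_csubspace_UNIV G(1,2)]) (rule G(3))
  have GJ: "G (J y) = y" "J (G y) = y" for y
    using G(2) by (simp_all add: J_def bij_is_surj surj_f_inv_f bij_is_inj)
  define S where "S = (\<lambda>x. J (G' x))"
  have S: "bounded_op UNIV S" unfolding S_def by (rule bounded_op_comp[OF J G'])
  have near: "norm (S x - x) \<le> 1 / 2 * norm x" for x
  proof -
    have "S x - x = J (G' x - G x)" by (simp add: S_def bounded_op_UNIVD[OF J] GJ)
    then have "norm (S x - x) \<le> C * norm (G' x - G x)" using G(3)[of "S x - x"] GJ(1) by metis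
    also have "\<dots> \<le> C * (\<epsilon> * norm x)" by (intro mult_left_mono close C)
    also have "\<dots> \<le> 1 / 2 * norm x"
      using mult_right_mono[OF small, of "norm x"] by (simp add: mult.assoc)
    finally show ?thesis .
  qed
  have "1 / 2 * (norm x)\<^sup>2 \<le> Re (cinner (S x) x)" for x
  proof -
    have "cmod (cinner (S x - x) x) \<le> norm (S x - x) * norm x" by (rule cmod_cinner_le)
    also have "\<dots> \<le> 1 / 2 * norm x * norm x" by (intro mult_right_mono near) simp
    finally have "- (1 / 2 * (norm x)\<^sup>2) \<le> Re (cinner (S x - x) x)"
      using abs_Re_le_cmod[of "cinner (S x - x) x"] by (simp add: power2_eq_square)
    then show ?thesis by (simp add: cinner_diff_left norm_sq_cinner[symmetric])
  qed
  then have "bij S" using lax_milgram[OF closed_csubspace_UNIV S, of "1 / 2"] by simp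
  moreover have "G' = G \<circ> S" by (simp add: fun_eq_iff S_def GJ)
  ultimately show "bij G'" using G(2) bij_comp by blast
  have "norm x \<le> norm (S x) + norm (S x - x)"
    using norm_triangle_ineq4[of "S x" "S x - x"] by simp
  then have "norm x \<le> 2 * norm (S x)" using near[of x] by simp
  also have "norm (S x) \<le> C * norm (G' x)" using G(3)[of "S x"] by (simp add: S_def GJ)
  finally show "norm x \<le> 2 * C * norm (G' x)" by simp
qed

text \<open>
  \<open>opnorm\<close> is a supremum in the reals, which is an upper bound only if the quotients are bounded; an
  arbitrary a priori constant \<open>D\<close> guarantees this.
\<close>

lemma opnorm_bound:
  assumes "\<And>x. norm (T x) \<le> D * norm x" "opnorm UNIV T \<le> c" "T 0 = 0"
  shows "norm (T x) \<le> c * norm x"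
proof (cases "x = 0")
  case False
  have "norm (T y) / norm y \<le> \<bar>D\<bar>" for y
    using order_trans[OF assms(1)[of y] mult_right_mono[OF abs_ge_self norm_ge_zero]]
    by (cases "y = 0") (auto simp: divide_le_eq)
  then have "bdd_above (range (\<lambda>y. norm (T y) / norm y))" by (intro bdd_aboveI) auto
  then have "norm (T x) / norm x \<le> opnorm UNIV T"
    unfolding opnorm_def by (intro cSUP_upper) auto
  then have "norm (T x) \<le> opnorm UNIV T * norm x" using False by (simp add: divide_le_eq)
  also have "\<dots> \<le> c * norm x" by (intro mult_right_mono assms(2)) simp
  finally show ?thesis .
qed (simp add: assms)

lemma E_contractionD:
  assumes "E_contraction M A B P"
  shows "bounded_op M A" "bounded_op M B" "bounded_op M P" "compact (closure tetrablock)"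
    "\<And>x. x \<in> M \<Longrightarrow> A (B x) = B (A x)" "\<And>x. x \<in> M \<Longrightarrow> A (P x) = P (A x)"
    "\<And>x. x \<in> M \<Longrightarrow> B (P x) = P (B x)"
    "(\<And>z. z \<in> closure tetrablock \<Longrightarrow> poly3_eval g z \<noteq> 0) \<Longrightarrow> opnorm M (rat3_op M f g A B P)
      \<le> (SUP z\<in>closure tetrablock. cmod (poly3_eval f z / poly3_eval g z))"
  using assms by (auto simp: E_contraction_def commuting_triple_def spectral_set_def)

text \<open>
  A bounded inverse of \<open>g(A,B,P)\<close> turns \<open>rat3_op\<close> into the operator \<open>f(A,B,P) g(A,B,P)\<^sup>-\<^sup>1\<close>, whose norm the
  spectral set controls.
\<close>

lemma rational_bound_if_invertible:
  fixes A B P :: "'a::complex_hilbert_space \<Rightarrow> 'a"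
  assumes E: "E_contraction UNIV A B P"
    and le: "\<And>z. z \<in> closure tetrablock \<Longrightarrow> cmod (poly3_eval f z) \<le> c * cmod (poly3_eval g z)"
    and nz: "\<And>z. z \<in> closure tetrablock \<Longrightarrow> poly3_eval g z \<noteq> 0"
    and bij: "bij (poly3_op g A B P)" and lower: "\<And>x. norm x \<le> D * norm (poly3_op g A B P x)"
  shows "norm (poly3_op f A B P x) \<le> c * norm (poly3_op g A B P x)"
proof -
  let ?f = "poly3_op f A B P" and ?g = "poly3_op g A B P"
  note ABP = E_contractionD(1-3)[OF E]
  have f: "bounded_op UNIV ?f" and g: "bounded_op UNIV ?g"
    by (intro bounded_op_poly3_op closed_csubspace_UNIV ABP)+
  have "bounded_op UNIV (inv ?g)"
    using bounded_op_inv_into[OF closed_csubspace_UNIV g bij] lower by blast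
  then have T: "bounded_op UNIV (rat3_op UNIV f g A B P)"
    using bounded_op_comp[OF f] by (simp add: rat3_op_def comp_def)
  obtain F where F: "\<And>x. norm (rat3_op UNIV f g A B P x) \<le> F * norm x"
    using bounded_op_bound[OF T] by auto
  have "opnorm UNIV (rat3_op UNIV f g A B P)
      \<le> (SUP z\<in>closure tetrablock. cmod (poly3_eval f z / poly3_eval g z))"
    by (rule E_contractionD(8)[OF E nz])
  also have "\<dots> \<le> c"
    using le nz zero_in_tetrablock closure_subset
    by (intro cSUP_least) (auto simp: norm_divide divide_le_eq)
  finally have "norm (rat3_op UNIV f g A B P (?g x)) \<le> c * norm (?g x)"
    by (rule opnorm_bound[OF F]) (rule bounded_op_UNIVD[OF T])
  moreover have "rat3_op UNIV f g A B P (?g x) = ?f x"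
    using bij by (simp add: rat3_op_def bij_is_inj)
  ultimately show ?thesis by simp
qed

text \<open>
  Along the path \<open>g\<^sub>t (x) = g (t x\<^sub>1, t x\<^sub>2, t\<^sup>2 x\<^sub>3)\<close>, \<open>0 \<le> t \<le> 1\<close>, the polynomials stay bounded away
  from zero on the closed tetrablock by the minimum of \<open>\<bar>g\<bar>\<close>. Since that set is spectral, the inverse of
  \<open>g\<^sub>t(A,B,P)\<close>, whenever it exists, has norm at most the reciprocal of this minimum. Such a uniform
  bound makes invertibility propagate from the scalar \<open>g\<^sub>0(A,B,P) = g(0)\<close> to \<open>g\<^sub>1(A,B,P) = g(A,B,P)\<close>.
\<close>

lemma poly3_op_invertible:
  fixes A B P :: "'a::complex_hilbert_space \<Rightarrow> 'a"
  assumes E: "E_contraction UNIV A B P"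
    and nz: "\<And>z. z \<in> closure tetrablock \<Longrightarrow> poly3_eval g z \<noteq> 0"
  shows "bij (poly3_op g A B P) \<and> (\<exists>D. \<forall>x. norm x \<le> D * norm (poly3_op g A B P x))"
proof -
  note ABP = E_contractionD(1-3)[OF E]
  have 0: "(0, 0, 0) \<in> closure tetrablock" using zero_in_tetrablock closure_subset by blast
  have "continuous_on (closure tetrablock) (\<lambda>z. cmod (poly3_eval g z))"
    by (intro continuous_on_norm continuous_on_poly3_eval)
  then obtain z0 where z0: "z0 \<in> closure tetrablock"
    "\<And>z. z \<in> closure tetrablock \<Longrightarrow> cmod (poly3_eval g z0) \<le> cmod (poly3_eval g z)"
    using continuous_attains_inf[OF E_contractionD(4)[OF E]] 0 by (metis empty_iff)
  define C where "C = 1 / cmod (poly3_eval g z0)"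
  have C: "C > 0" using nz[OF z0(1)] by (simp add: C_def)
  have lowerC: "1 \<le> C * cmod (poly3_eval g z)" if "z \<in> closure tetrablock" for z
    using z0(2)[OF that] nz[OF z0(1)] by (simp add: C_def)
  let ?G = "\<lambda>t. poly3_op (weighted_scale t g) A B P"
  have G: "bounded_op UNIV (?G t)" for t
    by (intro bounded_op_poly3_op closed_csubspace_UNIV ABP)
  define good where "good t \<longleftrightarrow> bij (?G t) \<and> (\<forall>x. norm x \<le> C * norm (?G t x))" for t
  have good: "good t"
    if t: "cmod t \<le> 1" and bij: "bij (?G t)" and D: "\<And>x. norm x \<le> D * norm (?G t x)" for t D
  proof -
    have low: "1 \<le> C * cmod (poly3_eval (weighted_scale t g) z)" if "z \<in> closure tetrablock" for z
      using that t by (cases z) (simp add: poly3_eval_weighted_scale lowerC closure_tetrablock_scale)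
    have one: "poly3_eval (Poly_Mapping.single (0, 0, 0) 1) z = 1" for z
      by (cases z) (simp add: poly3_simps)
    have "norm (poly3_op (Poly_Mapping.single (0, 0, 0) 1) A B P x) \<le> C * norm (?G t x)" for x
      by (rule rational_bound_if_invertible[OF E _ _ bij D])
        (use low in \<open>force simp: one\<close>)+
    then show ?thesis using bij by (simp add: good_def poly3_simps)
  qed
  have scalar: "?G 0 x = poly3_eval g (0, 0, 0) *\<^sub>C x" for x
  proof -
    have coeff: "weighted_scale 0 g = Poly_Mapping.single (0, 0, 0) (Poly_Mapping.lookup g (0, 0, 0))"
      by (rule poly_mapping_eqI) (auto simp: lookup_weighted_scale lookup_single when_def)
    then have "poly3_eval g (0, 0, 0) = Poly_Mapping.lookup g (0, 0, 0)"
      using poly3_eval_weighted_scale[of 0 g 0 0 0] by (simp add: poly3_simps)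
    then show ?thesis by (simp add: coeff poly3_simps)
  qed
  have good0: "good 0"
  proof (rule good)
    let ?c = "poly3_eval g (0, 0, 0)"
    have c: "?c \<noteq> 0" by (rule nz[OF 0])
    show "bij (?G 0)"
      by (rule bij_betw_byWitness[where f' = "\<lambda>x. (1 / ?c) *\<^sub>C x"]) (auto simp: scalar c)
    show "norm x \<le> (1 / cmod ?c) * norm (?G 0 x)" for x by (simp add: scalar c norm_scaleC)
  qed simp
  obtain L where L: "L > 0" "\<And>s t x. cmod s \<le> 1 \<Longrightarrow> cmod t \<le> 1 \<Longrightarrow>
      norm (?G s x - ?G t x) \<le> L * cmod (s - t) * norm x"
    using poly3_op_weighted_scale_Lipschitz[OF ABP] by blast
  \<comment> \<open>Steps of length \<open>1/N\<close> move \<open>g\<^sub>t(A,B,P)\<close> by at most \<open>L/N < 1/(2C)\<close>, half the reciprocal of the bound on the inverses.\<close>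
  obtain N :: nat where "2 * C * L < N" using reals_Archimedean2 by blast
  moreover have "0 < 2 * C * L" using C L(1) by simp
  ultimately have "2 * C * L < N" "0 < real N" by linarith+
  then have N: "2 * C * L < N" "N > 0" by simp_all
  have "good (complex_of_real (n / N))" if "n \<le> N" for n :: nat
    using that
  proof (induction n)
    case 0
    then show ?case using good0 by simp
  next
    case (Suc n)
    let ?s = "complex_of_real (n / N)" and ?t = "complex_of_real (Suc n / N)"
    have st: "cmod ?s \<le> 1" "cmod ?t \<le> 1"
      using Suc.prems unfolding norm_of_real by simp_all
    have "?t - ?s = complex_of_real (1 / N)" by (simp add: diff_divide_distrib[symmetric])
    then have dst: "cmod (?t - ?s) = 1 / N" by (metis norm_of_real abs_of_nonneg of_nat_0_le_iff zero_le_divide_1_iff)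
    have gs: "bij (?G ?s)" "\<And>x. norm x \<le> C * norm (?G ?s x)"
      using Suc by (simp_all add: good_def)
    have close: "norm (?G ?t x - ?G ?s x) \<le> (L / N) * norm x" for x
      using L(2)[OF st(2,1), of x] unfolding dst by simp
    have small: "C * (L / N) \<le> 1 / 2" using N by (simp add: field_simps)
    show ?case
      by (rule good[OF st(2), of "2 * C"];
          rule invertible_perturbation[OF G gs less_imp_le[OF C] G close small])
  qed
  from this[of N] have "good 1" using N by simp
  moreover have "?G 1 = poly3_op g A B P"
    by (rule ext, subst poly3_op_weighted_scale) (simp add: poly3_op_def)
  ultimately show ?thesis by (auto simp: good_def)
qed

lemma rational_bound:
  fixes A B P :: "'a::complex_hilbert_space \<Rightarrow> 'a"
  assumes E: "E_contraction UNIV A B P"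
    and nz: "\<And>z. z \<in> closure tetrablock \<Longrightarrow> poly3_eval g z \<noteq> 0"
    and le: "\<And>z. z \<in> closure tetrablock \<Longrightarrow> cmod (poly3_eval f z) \<le> c * cmod (poly3_eval g z)"
  shows "norm (poly3_op f A B P x) \<le> c * norm (poly3_op g A B P x)"
  using poly3_op_invertible[OF E nz] rational_bound_if_invertible[OF E le nz] by blast

text \<open>These are the spectral bounds for the rational functions \<open>(x\<^sub>2 - z x\<^sub>3) / (1 - z x\<^sub>1)\<close>
  and \<open>(x\<^sub>1 - z x\<^sub>3) / (1 - z x\<^sub>2)\<close>; their denominators may vanish when \<open>\<bar>z\<bar> = 1\<close>, so that case is a
  limit.\<close>

lemma linear_fractional_bound:
  fixes A B P :: "'a::complex_hilbert_space \<Rightarrow> 'a"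
  assumes E: "E_contraction UNIV A B P" and z: "cmod z \<le> 1"
  shows "norm (B x - z *\<^sub>C P x) \<le> norm (x - z *\<^sub>C A x)"
    and "norm (A x - z *\<^sub>C P x) \<le> norm (x - z *\<^sub>C B x)"
proof -
  have strict: "norm (B x - z *\<^sub>C P x) \<le> norm (x - z *\<^sub>C A x) \<and>
      norm (A x - z *\<^sub>C P x) \<le> norm (x - z *\<^sub>C B x)" if z: "cmod z < 1" for z
  proof -
    let ?s = "Poly_Mapping.single :: nat \<times> nat \<times> nat \<Rightarrow> complex \<Rightarrow> poly3"
    have nz: "1 - z * a \<noteq> 0" if "cmod a \<le> 1" for a
    proof
      assume "1 - z * a = 0"
      then have "cmod z * cmod a = 1" by (metis norm_mult norm_one right_minus_eq)
      then show False using mult_left_mono[OF that, of "cmod z"] z by simp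
    qed
    have cl: "cmod a \<le> 1" "cmod b \<le> 1" "cmod (b - z * p) \<le> cmod (1 - z * a)"
      "cmod (a - z * p) \<le> cmod (1 - z * b)" if "(a, b, p) \<in> closure tetrablock" for a b p
      using that closure_tetrablock_swap[OF that] z unfolding closure_tetrablock_iff by auto
    have "norm (poly3_op (?s (0,1,0) 1 + ?s (0,0,1) (- z)) A B P x)
        \<le> 1 * norm (poly3_op (?s (0,0,0) 1 + ?s (1,0,0) (- z)) A B P x)"
      by (rule rational_bound[OF E]; clarify) (use cl nz in \<open>auto simp: poly3_simps\<close>)
    moreover have "norm (poly3_op (?s (1,0,0) 1 + ?s (0,0,1) (- z)) A B P x)
        \<le> 1 * norm (poly3_op (?s (0,0,0) 1 + ?s (0,1,0) (- z)) A B P x)"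
      by (rule rational_bound[OF E]; clarify) (use cl nz in \<open>auto simp: poly3_simps\<close>)
    ultimately show ?thesis by (simp add: poly3_simps)
  qed
  define r where "r = (\<lambda>n. complex_of_real (1 - inverse (real (Suc n))))"
  have "cmod (r n * z) < 1" for n
  proof -
    have "cmod (r n) < 1" unfolding r_def norm_of_real by (simp add: field_simps)
    then show ?thesis using mult_left_mono[OF z, of "cmod (r n)"] by (simp add: norm_mult)
  qed
  note strict = strict[OF this]
  have "r \<longlonglongrightarrow> complex_of_real 1"
    unfolding r_def
    by (intro tendsto_of_real) (use LIMSEQ_inverse_real_of_nat_add_minus[of 1] in simp)
  then have rz: "(\<lambda>n. r n * z) \<longlonglongrightarrow> z" using tendsto_mult_right[of r 1 sequentially z] by simp
  have lim: "(\<lambda>n. norm (u - (r n * z) *\<^sub>C v)) \<longlonglongrightarrow> norm (u - z *\<^sub>C v)" for u v :: 'a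
  proof (intro tendsto_norm tendsto_diff tendsto_const)
    have "bounded_linear (\<lambda>c. c *\<^sub>C v)"
      by (rule bounded_linear_intro[where K = "norm v"])
        (simp_all add: scaleC_add_left norm_scaleC scaleR_eq_scaleC scaleC_complex_def scaleC_scaleC)
    then show "(\<lambda>n. (r n * z) *\<^sub>C v) \<longlonglongrightarrow> z *\<^sub>C v" by (rule bounded_linear.tendsto[OF _ rz])
  qed
  show "norm (B x - z *\<^sub>C P x) \<le> norm (x - z *\<^sub>C A x)"
    by (rule LIMSEQ_le[OF lim lim]) (use strict in blast)
  show "norm (A x - z *\<^sub>C P x) \<le> norm (x - z *\<^sub>C B x)"
    by (rule LIMSEQ_le[OF lim lim]) (use strict in blast)
qed

lemma E_contraction_norm_A_le:
  fixes A B P :: "'a::complex_hilbert_space \<Rightarrow> 'a"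
  assumes E: "E_contraction UNIV A B P"
  shows "norm (A x) \<le> norm x"
proof -
  let ?s = "Poly_Mapping.single :: nat \<times> nat \<times> nat \<Rightarrow> complex \<Rightarrow> poly3"
  have "norm (poly3_op (?s (1,0,0) 1) A B P x) \<le> 1 * norm (poly3_op (?s (0,0,0) 1) A B P x)"
    by (rule rational_bound[OF E]; clarify) (auto simp: poly3_simps closure_tetrablock_iff)
  then show ?thesis by (simp add: poly3_simps)
qed

section \<open>The equality case of the linear fractional inequalities\<close>

lemma norm_sq_add_reflected:
  assumes "cmod z = 1"
  shows "(norm (u - z *\<^sub>C v))\<^sup>2 + (norm (u - (- z) *\<^sub>C v))\<^sup>2 = 2 * (norm u)\<^sup>2 + 2 * (norm v)\<^sup>2"
  unfolding norm_diff_scaleC_sq by (simp add: assms)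

text \<open>Averaging the squared inequalities over \<open>z\<close> and \<open>-z\<close> removes the terms linear in \<open>z\<close>.\<close>

lemma E_contraction_parallelogram:
  fixes A B P :: "'a::complex_hilbert_space \<Rightarrow> 'a"
  assumes E: "E_contraction UNIV A B P"
  shows "(norm (B x))\<^sup>2 + (norm (P x))\<^sup>2 \<le> (norm x)\<^sup>2 + (norm (A x))\<^sup>2"
    and "(norm (A x))\<^sup>2 + (norm (P x))\<^sup>2 \<le> (norm x)\<^sup>2 + (norm (B x))\<^sup>2"
proof -
  have le: "(norm (B x - z *\<^sub>C P x))\<^sup>2 \<le> (norm (x - z *\<^sub>C A x))\<^sup>2"
    "(norm (A x - z *\<^sub>C P x))\<^sup>2 \<le> (norm (x - z *\<^sub>C B x))\<^sup>2" if "cmod z \<le> 1" for z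
    using linear_fractional_bound[OF E that] by (auto intro: power_mono)
  obtain z :: complex where z: "cmod z = 1" using norm_one by blast
  then have zs: "cmod z \<le> 1" "cmod (- z) \<le> 1" by simp_all
  show "(norm (B x))\<^sup>2 + (norm (P x))\<^sup>2 \<le> (norm x)\<^sup>2 + (norm (A x))\<^sup>2"
    using le(1)[OF zs(1)] le(1)[OF zs(2)]
      norm_sq_add_reflected[OF z, of "B x" "P x"] norm_sq_add_reflected[OF z, of x "A x"] by linarith
  show "(norm (A x))\<^sup>2 + (norm (P x))\<^sup>2 \<le> (norm x)\<^sup>2 + (norm (B x))\<^sup>2"
    using le(2)[OF zs(1)] le(2)[OF zs(2)]
      norm_sq_add_reflected[OF z, of "A x" "P x"] norm_sq_add_reflected[OF z, of x "B x"] by linarith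
qed

lemma E_contraction_norm_P_le:
  fixes A B P :: "'a::complex_hilbert_space \<Rightarrow> 'a"
  assumes "E_contraction UNIV A B P"
  shows "norm (P x) \<le> norm x"
proof (rule power2_le_imp_le)
  show "(norm (P x))\<^sup>2 \<le> (norm x)\<^sup>2" using E_contraction_parallelogram[OF assms, of x] by linarith
qed simp

text \<open>
  The four squared inequalities for \<open>z\<close> and \<open>-z\<close> have total slack \<open>4 (\<parallel>x\<parallel>\<^sup>2 - \<parallel>P x\<parallel>\<^sup>2)\<close>.
\<close>

lemma linear_fractional_equality:
  fixes A B P :: "'a::complex_hilbert_space \<Rightarrow> 'a"
  assumes E: "E_contraction UNIV A B P" and x: "norm (P x) = norm x" and z: "cmod z = 1"
  shows "norm (B x - z *\<^sub>C P x) = norm (x - z *\<^sub>C A x)"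
    and "norm (A x - z *\<^sub>C P x) = norm (x - z *\<^sub>C B x)"
proof -
  have AB: "(norm (A x))\<^sup>2 = (norm (B x))\<^sup>2"
    using E_contraction_parallelogram[OF E, of x] x by simp
  have le: "(norm (B x - w *\<^sub>C P x))\<^sup>2 \<le> (norm (x - w *\<^sub>C A x))\<^sup>2"
    "(norm (A x - w *\<^sub>C P x))\<^sup>2 \<le> (norm (x - w *\<^sub>C B x))\<^sup>2" if "cmod w \<le> 1" for w
    using linear_fractional_bound[OF E that] by (auto intro: power_mono)
  from z have zs: "cmod z \<le> 1" "cmod (- z) \<le> 1" by simp_all
  have "(norm (B x - z *\<^sub>C P x))\<^sup>2 = (norm (x - z *\<^sub>C A x))\<^sup>2"
    using le(1)[OF zs(1)] le(1)[OF zs(2)] norm_sq_add_reflected[OF z, of "B x" "P x"]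
      norm_sq_add_reflected[OF z, of x "A x"] AB unfolding x by linarith
  then show "norm (B x - z *\<^sub>C P x) = norm (x - z *\<^sub>C A x)" by (simp add: power2_eq_iff_nonneg)
  have "(norm (A x - z *\<^sub>C P x))\<^sup>2 = (norm (x - z *\<^sub>C B x))\<^sup>2"
    using le(2)[OF zs(1)] le(2)[OF zs(2)] norm_sq_add_reflected[OF z, of "A x" "P x"]
      norm_sq_add_reflected[OF z, of x "B x"] AB unfolding x by linarith
  then show "norm (A x - z *\<^sub>C P x) = norm (x - z *\<^sub>C B x)" by (simp add: power2_eq_iff_nonneg)
qed

text \<open>A nonnegative quadratic form vanishes at \<open>x\<close> only if \<open>x\<close> is in the kernel of its
  sesquilinear form; here for the form \<open>\<parallel>Rx\<parallel>\<^sup>2 - \<parallel>Sx\<parallel>\<^sup>2\<close>.\<close>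

lemma cinner_eq_if_norm_eq:
  fixes R S :: "'a::complex_hilbert_space \<Rightarrow> 'a"
  assumes R: "bounded_op UNIV R" and S: "bounded_op UNIV S"
    and le: "\<And>y. norm (S y) \<le> norm (R y)" and eq: "norm (S x) = norm (R x)"
  shows "cinner (R x) (R y) = cinner (S x) (S y)"
proof -
  define c where "c = cinner (R x) (R y) - cinner (S x) (S y)"
  define d where "d = (norm (R y))\<^sup>2 - (norm (S y))\<^sup>2"
  have d: "d \<ge> 0" using le[of y] by (simp add: d_def power_mono)
  \<comment> \<open>Along \<open>x - t c y\<close> the form is \<open>t \<bar>c\<bar>\<^sup>2 (t d - 2)\<close>, which is negative for this \<open>t\<close> unless \<open>c = 0\<close>.\<close>
  define t where "t = 1 / (d + 1)"
  have t: "t > 0" "t * d < 1" using d by (simp_all add: t_def)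
  define w where "w = complex_of_real t * c"
  have "(norm (S (x - w *\<^sub>C y)))\<^sup>2 \<le> (norm (R (x - w *\<^sub>C y)))\<^sup>2" using le by (intro power_mono) auto
  then have "2 * Re (w * cinner (R y) (R x)) - 2 * Re (w * cinner (S y) (S x)) \<le> (cmod w)\<^sup>2 * d"
    unfolding bounded_op_UNIVD[OF R] bounded_op_UNIVD[OF S] norm_diff_scaleC_sq
    using eq by (simp add: d_def algebra_simps)
  moreover have "w * cinner (R y) (R x) - w * cinner (S y) (S x) = complex_of_real t * (c * cnj c)"
    by (simp add: w_def c_def cinner_commute[of "R y"] cinner_commute[of "S y"] algebra_simps)
  then have "w * cinner (R y) (R x) - w * cinner (S y) (S x) = complex_of_real (t * (cmod c)\<^sup>2)"
    by (simp only: complex_norm_square of_real_mult)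
  then have "Re (w * cinner (R y) (R x)) - Re (w * cinner (S y) (S x)) = t * (cmod c)\<^sup>2"
    by (metis Re_complex_of_real minus_complex.simps(1))
  moreover have "(cmod w)\<^sup>2 * d = t * (t * d) * (cmod c)\<^sup>2"
    by (simp add: w_def norm_mult power_mult_distrib power2_eq_square)
  ultimately have "2 * (t * (cmod c)\<^sup>2) \<le> t * (t * d) * (cmod c)\<^sup>2" by linarith
  also have "\<dots> \<le> t * 1 * (cmod c)\<^sup>2" using t by (intro mult_right_mono mult_left_mono) auto
  finally have "t * (cmod c)\<^sup>2 \<le> 0" by simp
  then show ?thesis using t by (simp add: mult_le_0_iff c_def)
qed

text \<open>
  Polarising the equalities gives an identity between trigonometric polynomials in \<open>z\<close> on the unit circle, and
  these are its coefficients at \<open>z\<close> and at the conjugate of \<open>z\<close>. In operator terms,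
  \<open>A x = B\<^sup>* P x\<close>, \<open>A\<^sup>* x = P\<^sup>* B x\<close>, \<open>B x = A\<^sup>* P x\<close> and \<open>B\<^sup>* x = P\<^sup>* A x\<close>.
\<close>

lemma cinner_A_eq_if_norm_P_eq:
  fixes A B P :: "'a::complex_hilbert_space \<Rightarrow> 'a"
  assumes E: "E_contraction UNIV A B P" and x: "norm (P x) = norm x"
  shows "cinner (A x) y = cinner (P x) (B y)" "cinner x (A y) = cinner (B x) (P y)"
    and "cinner (B x) y = cinner (P x) (A y)" "cinner x (B y) = cinner (A x) (P y)"
proof -
  note ABP = E_contractionD(1-3)[OF E]
  have split: "p = p' \<and> q = q'"
    if "\<And>z. cmod z = 1 \<Longrightarrow> z * p + cnj z * q + r = z * p' + cnj z * q' + r'" for p q r p' q' r' :: complex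
  proof -
    have e: "p + q + r = p' + q' + r'" "- p - q + r = - p' - q' + r'"
      "\<i> * p - \<i> * q + r = \<i> * p' - \<i> * q' + r'" "- \<i> * p + \<i> * q + r = - \<i> * p' + \<i> * q' + r'"
      using that[of 1] that[of "-1"] that[of "\<i>"] that[of "- \<i>"] by simp_all
    have "2 * \<i> * (p - q) = 2 * \<i> * (p' - q')" using e(3,4) by algebra
    then have "p - q = p' - q'" by simp
    moreover have "p + q = p' + q'" using e(1,2) by algebra
    ultimately have "2 * p = 2 * p'" "2 * q = 2 * q'" by algebra+
    then show ?thesis by simp
  qed
  have "cinner (A x) y = cinner (P x) (B y) \<and> cinner x (A y) = cinner (B x) (P y)"
  proof (rule split)
    fix z :: complex assume z: "cmod z = 1"
    have zz: "z * cnj z = 1" using complex_norm_square[of z] z by simp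
    have "cinner (x - z *\<^sub>C A x) (y - z *\<^sub>C A y) = cinner (B x - z *\<^sub>C P x) (B y - z *\<^sub>C P y)"
      using linear_fractional_bound(1)[OF E, of z] linear_fractional_equality(1)[OF E x z] z
      by (intro cinner_eq_if_norm_eq[where R = "\<lambda>x. x - z *\<^sub>C A x" and S = "\<lambda>x. B x - z *\<^sub>C P x"]
          bounded_op_diff_scaleC closed_csubspace_UNIV ABP bounded_op_id) auto
    then show "z * cinner (A x) y + cnj z * cinner x (A y)
          + - (cinner x y + cinner (A x) (A y))
        = z * cinner (P x) (B y) + cnj z * cinner (B x) (P y) + - (cinner (B x) (B y) + cinner (P x) (P y))"
      unfolding cinner_simps using zz by algebra
  qed
  moreover have "cinner (B x) y = cinner (P x) (A y) \<and> cinner x (B y) = cinner (A x) (P y)"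
  proof (rule split)
    fix z :: complex assume z: "cmod z = 1"
    have zz: "z * cnj z = 1" using complex_norm_square[of z] z by simp
    have "cinner (x - z *\<^sub>C B x) (y - z *\<^sub>C B y) = cinner (A x - z *\<^sub>C P x) (A y - z *\<^sub>C P y)"
      using linear_fractional_bound(2)[OF E, of z] linear_fractional_equality(2)[OF E x z] z
      by (intro cinner_eq_if_norm_eq[where R = "\<lambda>x. x - z *\<^sub>C B x" and S = "\<lambda>x. A x - z *\<^sub>C P x"]
          bounded_op_diff_scaleC closed_csubspace_UNIV ABP bounded_op_id) auto
    then show "z * cinner (B x) y + cnj z * cinner x (B y)
          + - (cinner x y + cinner (B x) (B y))
        = z * cinner (P x) (A y) + cnj z * cinner (A x) (P y) + - (cinner (A x) (A y) + cinner (P x) (P y))"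
      unfolding cinner_simps using zz by algebra
  qed
  ultimately show "cinner (A x) y = cinner (P x) (B y)" "cinner x (A y) = cinner (B x) (P y)"
    "cinner (B x) y = cinner (P x) (A y)" "cinner x (B y) = cinner (A x) (P y)" by auto
qed

section \<open>The weakly stable part of a contraction\<close>

definition weakly_stable_part :: "('a::complex_hilbert_space \<Rightarrow> 'a) \<Rightarrow> 'a set" where
  "weakly_stable_part P = {x. \<forall>y. (\<lambda>k. cinner ((P ^^ k) x) y) \<longlonglongrightarrow> 0}"

lemma norm_funpow_le:
  fixes T :: "'a::real_normed_vector \<Rightarrow> 'a"
  assumes "\<And>x. norm (T x) \<le> norm x"
  shows "norm ((T ^^ n) x) \<le> norm x"
proof (induction n)
  case (Suc n)
  then show ?case using order_trans[OF assms[of "(T ^^ n) x"]] by simp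
qed simp

lemma closed_csubspace_weakly_stable_part:
  assumes P: "bounded_op UNIV P" and contr: "\<And>x. norm (P x) \<le> norm x"
  shows "closed_csubspace (weakly_stable_part P)"
proof -
  have lin: "(P ^^ k) (x + y) = (P ^^ k) x + (P ^^ k) y" "(P ^^ k) (c *\<^sub>C x) = c *\<^sub>C (P ^^ k) x"
    "(P ^^ k) (x - y) = (P ^^ k) x - (P ^^ k) y" "(P ^^ k) 0 = 0"
    for k c x y
    using bounded_op_UNIVD[OF bounded_op_funpow[OF P]] by blast+
  have "closed (weakly_stable_part P)"
    unfolding closed_sequential_limits
  proof (intro allI impI, elim conjE)
    fix x l assume x: "\<forall>n. x n \<in> weakly_stable_part P" and l: "x \<longlonglongrightarrow> l"
    have "(\<lambda>k. cinner ((P ^^ k) l) y) \<longlonglongrightarrow> 0" for y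
    proof (rule LIMSEQ_I)
      fix e :: real assume e: "e > 0"
      define m where "m = norm y + 1"
      have m: "m > 0" "norm y \<le> m" by (simp_all add: m_def add_nonneg_pos)
      define d where "d = e / (2 * m)"
      have d: "d > 0" using e m by (simp add: d_def)
      then obtain n where n: "norm (x n - l) < d" using LIMSEQ_D[OF l d] by blast
      have "(\<lambda>k. cinner ((P ^^ k) (x n)) y) \<longlonglongrightarrow> 0" using x by (simp add: weakly_stable_part_def)
      then obtain K where K: "\<And>k. k \<ge> K \<Longrightarrow> cmod (cinner ((P ^^ k) (x n)) y) < e / 2"
        using LIMSEQ_D[of _ 0 "e / 2"] e by auto
      have "cmod (cinner ((P ^^ k) l) y) < e" if k: "k \<ge> K" for k
      proof -
        have "cmod (cinner ((P ^^ k) (x n - l)) y) \<le> norm ((P ^^ k) (x n - l)) * norm y"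
          by (rule cmod_cinner_le)
        also have "\<dots> \<le> d * m"
          using norm_funpow_le[OF contr, of k "x n - l"] n d m by (intro mult_mono) auto
        also have "\<dots> = e / 2" using m by (simp add: d_def)
        finally have "cmod (cinner ((P ^^ k) (x n - l)) y) \<le> e / 2" .
        moreover have "cinner ((P ^^ k) l) y = cinner ((P ^^ k) (x n)) y - cinner ((P ^^ k) (x n - l)) y"
          by (simp add: lin cinner_diff_left)
        ultimately show ?thesis
          using K[OF k] norm_triangle_ineq4[of "cinner ((P ^^ k) (x n)) y" "cinner ((P ^^ k) (x n - l)) y"]
          by simp
      qed
      then show "\<exists>K. \<forall>k\<ge>K. norm (cinner ((P ^^ k) l) y - 0) < e" by auto
    qed
    then show "l \<in> weakly_stable_part P" by (simp add: weakly_stable_part_def)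
  qed
  then show ?thesis
    unfolding closed_csubspace_def weakly_stable_part_def
    by (auto simp: lin cinner_simps intro: tendsto_add_zero tendsto_mult_right_zero)
qed

lemma weakly_stable_part_commutant:
  assumes Q: "bounded_op UNIV Q" and comm: "\<And>x. Q (P x) = P (Q x)" and x: "x \<in> weakly_stable_part P"
  shows "Q x \<in> weakly_stable_part P"
proof -
  have "(P ^^ k) (Q x) = Q ((P ^^ k) x)" for k by (induction k) (auto simp: comm)
  then show ?thesis
    using x by (simp add: weakly_stable_part_def cinner_adj[OF Q])
qed

text \<open>\<open>\<parallel>STu - u\<parallel>\<^sup>2 \<le> \<parallel>u\<parallel>\<^sup>2 - \<parallel>Tu\<parallel>\<^sup>2\<close> for \<open>S = T\<^sup>*\<close>, and \<open>\<parallel>T\<^sup>n y\<parallel>\<close> decreases to a limit.\<close>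

lemma isometric_defect_tendsto_zero:
  assumes T: "\<And>x. norm (T x) \<le> norm x" and S: "\<And>x. norm (S x) \<le> norm x"
    and adjoint: "\<And>x y. cinner (T x) y = cinner x (S y)"
  shows "(\<lambda>n. norm (S (T ((T ^^ n) y)) - (T ^^ n) y)) \<longlonglongrightarrow> 0"
proof -
  let ?a = "\<lambda>n. (norm ((T ^^ n) y))\<^sup>2"
  have defect: "(norm (S (T u) - u))\<^sup>2 \<le> (norm u)\<^sup>2 - (norm (T u))\<^sup>2" for u
  proof -
    have "cinner u (S (T u)) = (norm (T u))\<^sup>2" by (simp add: adjoint[symmetric] cinner_self)
    then have "(norm (S (T u) - u))\<^sup>2 = (norm (S (T u)))\<^sup>2 + (norm u)\<^sup>2 - 2 * (norm (T u))\<^sup>2"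
      using norm_diff_scaleC_sq[of "S (T u)" 1 u] by simp
    moreover have "(norm (S (T u)))\<^sup>2 \<le> (norm (T u))\<^sup>2" by (intro power_mono S) simp
    ultimately show ?thesis by simp
  qed
  have "decseq ?a" by (intro decseq_SucI power_mono) (simp_all add: T)
  then obtain l where l: "?a \<longlonglongrightarrow> l" using decseq_convergent[of ?a 0] by auto
  have "(\<lambda>n. ?a n - ?a (Suc n)) \<longlonglongrightarrow> l - l" by (intro tendsto_diff l LIMSEQ_Suc)
  then have "(\<lambda>n. ?a n - ?a (Suc n)) \<longlonglongrightarrow> 0" by simp
  then have "(\<lambda>n. (norm (S (T ((T ^^ n) y)) - (T ^^ n) y))\<^sup>2) \<longlonglongrightarrow> 0"
    by (rule tendsto_sandwich[OF _ _ tendsto_const, rotated 2])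
      (auto intro!: always_eventually defect)
  then have "(\<lambda>n. sqrt ((norm (S (T ((T ^^ n) y)) - (T ^^ n) y))\<^sup>2)) \<longlonglongrightarrow> sqrt 0"
    by (rule tendsto_real_sqrt)
  then show ?thesis by simp
qed

lemma cinner_adj_funpow:
  assumes "bounded_op UNIV P"
  shows "cinner ((P ^^ k) x) y = cinner x ((adj UNIV P ^^ k) y)"
  by (induction k arbitrary: y) (simp_all add: cinner_adj[OF assms] funpow_swap1[of "adj UNIV P"])

text \<open>
  Let \<open>D\<close> be one of the defect operators \<open>1 - PP\<^sup>*\<close> and \<open>1 - P\<^sup>*P\<close>. It is self-adjoint, so
  \<open>\<langle>P\<^sup>k D x, y\<rangle> = \<langle>x, D P\<^sup>*\<^sup>k y\<rangle>\<close>, and \<open>D P\<^sup>*\<^sup>k y\<close> tends to zero. For the second operator this is reduced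
  to the first one by \<open>(1 - P\<^sup>*P) P\<^sup>* = P\<^sup>* (1 - PP\<^sup>*)\<close>, which costs one power of \<open>P\<^sup>*\<close>.
\<close>

lemma defect_in_weakly_stable_part:
  fixes P :: "'a::complex_hilbert_space \<Rightarrow> 'a"
  assumes P: "bounded_op UNIV P" and contr: "\<And>x. norm (P x) \<le> norm x"
  shows "x - P (adj UNIV P x) \<in> weakly_stable_part P" "x - adj UNIV P (P x) \<in> weakly_stable_part P"
proof -
  let ?S = "adj UNIV P"
  note S = bounded_op_adj[OF P] 
    and S_contr = norm_adj_le[OF P zero_le_one, simplified, OF contr]
  have small: "(\<lambda>k. norm (P (?S ((?S ^^ k) y)) - (?S ^^ k) y)) \<longlonglongrightarrow> 0" for y
    by (rule isometric_defect_tendsto_zero[OF S_contr contr cinner_adj'[OF P]])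
  have small': "(\<lambda>k. norm ((?S ^^ k) y - P (?S ((?S ^^ k) y)))) \<longlonglongrightarrow> 0" for y
    using small[of y] by (simp add: norm_minus_commute)
  have bound: "(\<lambda>k. cinner x (v k)) \<longlonglongrightarrow> 0" if "(\<lambda>k. norm (v k)) \<longlonglongrightarrow> 0" for v
    using bounded_linear.tendsto[OF bounded_linear_cinner_right, of v 0] tendsto_norm_zero_cancel[OF that]
    by simp
  have "(\<lambda>k. cinner ((P ^^ k) (x - P (?S x))) y) \<longlonglongrightarrow> 0" for y
  proof -
    have "cinner ((P ^^ k) (x - P (?S x))) y = cinner x ((?S ^^ k) y - P (?S ((?S ^^ k) y)))" for k
      by (simp add: cinner_adj_funpow[OF P] cinner_simps cinner_adj[OF P] cinner_adj'[OF P])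
    then show ?thesis using bound[OF small'] by simp
  qed
  then show "x - P (?S x) \<in> weakly_stable_part P" by (simp add: weakly_stable_part_def)
  have "(\<lambda>k. cinner ((P ^^ k) (x - ?S (P x))) y) \<longlonglongrightarrow> 0" for y
  proof -
    have "cinner ((P ^^ Suc k) (x - ?S (P x))) y = cinner x (?S ((?S ^^ k) y - P (?S ((?S ^^ k) y))))" for k
    proof -
      have "cinner ((P ^^ Suc k) (x - ?S (P x))) y = cinner (x - ?S (P x)) ((?S ^^ Suc k) y)"
        by (rule cinner_adj_funpow[OF P])
      also have "\<dots> = cinner x (?S ((?S ^^ k) y - P (?S ((?S ^^ k) y))))"
        by (simp add: cinner_simps cinner_adj[OF P] cinner_adj'[OF P] bounded_op_UNIVD[OF S])
      finally show ?thesis .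
    qed
    moreover have "(\<lambda>k. norm (?S ((?S ^^ k) y - P (?S ((?S ^^ k) y))))) \<longlonglongrightarrow> 0"
      by (rule tendsto_sandwich[OF _ _ tendsto_const small'])
        (auto intro: always_eventually S_contr)
    ultimately have "(\<lambda>k. cinner ((P ^^ Suc k) (x - ?S (P x))) y) \<longlonglongrightarrow> 0" using bound by simp
    then show ?thesis by (rule LIMSEQ_imp_Suc)
  qed
  then show "x - ?S (P x) \<in> weakly_stable_part P" by (simp add: weakly_stable_part_def)
qed

text \<open>A vector orthogonal to the range of a self-adjoint operator is in its kernel.\<close>

lemma unitary_on_ortho_compl_weakly_stable_part:
  fixes P :: "'a::complex_hilbert_space \<Rightarrow> 'a"
  assumes P: "bounded_op UNIV P" and contr: "\<And>x. norm (P x) \<le> norm x"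
    and x: "x \<in> ortho_compl (weakly_stable_part P)"
  shows "P (adj UNIV P x) = x" "adj UNIV P (P x) = x"
proof -
  let ?S = "adj UNIV P"
  have "cinner w (x - P (?S x)) = 0" "cinner w (x - ?S (P x)) = 0" for w
  proof -
    have "cinner (w - P (?S w)) x = 0" "cinner (w - ?S (P w)) x = 0"
      using x defect_in_weakly_stable_part[OF P contr] unfolding ortho_compl_def by blast+
    then show "cinner w (x - P (?S x)) = 0" "cinner w (x - ?S (P x)) = 0"
      by (simp_all add: cinner_simps cinner_adj[OF P] cinner_adj'[OF P])
  qed
  from this(1)[of "x - P (?S x)"] this(2)[of "x - ?S (P x)"]
  show "P (?S x) = x" "?S (P x) = x" by (simp_all add: cinner_self)
qed

text \<open>\<open>P\<^sup>k\<^sup>+\<^sup>1 P\<^sup>* x = P\<^sup>k x - P\<^sup>k (1 - PP\<^sup>*) x\<close>, and both terms tend weakly to zero.\<close>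

lemma weakly_stable_part_adj:
  fixes P :: "'a::complex_hilbert_space \<Rightarrow> 'a"
  assumes P: "bounded_op UNIV P" and contr: "\<And>x. norm (P x) \<le> norm x"
    and x: "x \<in> weakly_stable_part P"
  shows "adj UNIV P x \<in> weakly_stable_part P"
proof -
  let ?S = "adj UNIV P"
  have lin: "(P ^^ k) (u - v) = (P ^^ k) u - (P ^^ k) v" for k u v
    using bounded_op_UNIVD[OF bounded_op_funpow[OF P]] by blast
  have "(\<lambda>k. cinner ((P ^^ k) (?S x)) y) \<longlonglongrightarrow> 0" for y
  proof -
    have "(P ^^ Suc k) (?S x) = (P ^^ k) x - (P ^^ k) (x - P (?S x))" for k
      by (simp add: lin funpow_swap1)
    moreover have "(\<lambda>k. cinner ((P ^^ k) x) y - cinner ((P ^^ k) (x - P (?S x))) y) \<longlonglongrightarrow> 0 - 0"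
      using x defect_in_weakly_stable_part(1)[OF P contr, of x]
      by (intro tendsto_diff) (simp_all add: weakly_stable_part_def)
    ultimately have "(\<lambda>k. cinner ((P ^^ Suc k) (?S x)) y) \<longlonglongrightarrow> 0"
      by (simp add: cinner_diff_left)
    then show ?thesis by (rule LIMSEQ_imp_Suc)
  qed
  then show ?thesis by (simp add: weakly_stable_part_def)
qed

lemma ortho_compl_invariant_if_adj_invariant:
  assumes T: "bounded_op UNIV T" and "\<And>x. x \<in> M \<Longrightarrow> adj UNIV T x \<in> M" and "x \<in> ortho_compl M"
  shows "T x \<in> ortho_compl M"
  using assms(2,3) by (simp add: ortho_compl_def flip: cinner_adj'[OF T])

lemma ortho_compl_adj_invariant:
  assumes T: "bounded_op UNIV T" and "\<And>x. x \<in> M \<Longrightarrow> T x \<in> M" and "x \<in> ortho_compl M"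
  shows "adj UNIV T x \<in> ortho_compl M"
  using assms(2,3) by (simp add: ortho_compl_def flip: cinner_adj[OF T])

lemma adj_invariant_if_ortho_compl_invariant:
  assumes M: "closed_csubspace M" and T: "bounded_op UNIV T"
    and "\<And>x. x \<in> ortho_compl M \<Longrightarrow> T x \<in> ortho_compl M" and "x \<in> M"
  shows "adj UNIV T x \<in> M"
  using ortho_compl_adj_invariant[OF T, of "ortho_compl M" x] assms
  by (simp add: ortho_compl_ortho_compl)

section \<open>Restriction to reducing subspaces\<close>

lemma orthogonal_projection:
  fixes M :: "'a::complex_hilbert_space set"
  assumes M: "closed_csubspace M"
  obtains Q where "bounded_op UNIV Q" "\<And>x. Q x \<in> M" "\<And>x. x - Q x \<in> ortho_compl M"
    "\<And>x y. y \<in> M \<Longrightarrow> x - y \<in> ortho_compl M \<Longrightarrow> Q x = y"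
proof -
  obtain Q where Q: "\<And>x. Q x \<in> M" "\<And>x. x - Q x \<in> ortho_compl M"
    using orthogonal_decomposition[OF M] by metis
  note cl = closed_csubspaceD(2-6)[OF M]
    and cl' = closed_csubspaceD(2-6)[OF closed_csubspace_ortho_compl[of M]]
  have eq: "Q x = y" if "y \<in> M" "x - y \<in> ortho_compl M" for x y
  proof -
    have "Q x - y \<in> M" "(x - y) - (x - Q x) \<in> ortho_compl M"
      by (rule cl(5)[OF Q(1) that(1)], rule cl'(5)[OF that(2) Q(2)])
    then have "Q x - y = 0" by (intro ortho_compl_Int) auto
    then show ?thesis by simp
  qed
  have "bounded_op UNIV Q"
  proof (rule bounded_opI[where C = 1])
    fix x y
    have "(x - Q x) + (y - Q y) \<in> ortho_compl M" by (rule cl'(2)[OF Q(2) Q(2)])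
    then show "Q (x + y) = Q x + Q y"
      by (intro eq cl(2)[OF Q(1) Q(1)]) (simp add: algebra_simps)
  next
    fix c x
    have "c *\<^sub>C (x - Q x) \<in> ortho_compl M" by (rule cl'(3)[OF Q(2)])
    then show "Q (c *\<^sub>C x) = c *\<^sub>C Q x"
      by (intro eq cl(3)[OF Q(1)]) (simp add: cvs.scale_right_diff_distrib)
  next
    fix x
    have "cinner (Q x) (x - Q x) = 0" using Q unfolding ortho_compl_def by blast
    then have "(norm (Q x))\<^sup>2 = Re (cinner (Q x) x)" by (simp add: cinner_diff_right norm_sq_cinner)
    also have "\<dots> \<le> norm (Q x) * norm x" using complex_Re_le_cmod cmod_cinner_le order_trans by blast
    finally show "norm (Q x) \<le> 1 * norm x" by (cases "Q x = 0") (simp_all add: power2_eq_square)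
  qed simp
  then show ?thesis using that Q eq by blast
qed

text \<open>
  The orthogonal projection onto a reducing subspace commutes with \<open>g(A,B,P)\<close>. So it carries solutions of
  \<open>g(A,B,P) y = x\<close> for \<open>x\<close> in the subspace into the subspace, and the rational bounds are inherited.
\<close>

lemma E_contraction_reducing:
  fixes A B P :: "'a::complex_hilbert_space \<Rightarrow> 'a"
  assumes E: "E_contraction UNIV A B P" and M: "closed_csubspace M"
    and A: "A ` M \<subseteq> M" "A ` ortho_compl M \<subseteq> ortho_compl M"
    and B: "B ` M \<subseteq> M" "B ` ortho_compl M \<subseteq> ortho_compl M"
    and P: "P ` M \<subseteq> M" "P ` ortho_compl M \<subseteq> ortho_compl M"
  shows "E_contraction M A B P"
proof -
  note ABP = E_contractionD(1-3)[OF E]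
  obtain Q where Q: "bounded_op UNIV Q" "\<And>x. Q x \<in> M" "\<And>x. x - Q x \<in> ortho_compl M"
    "\<And>x y. y \<in> M \<Longrightarrow> x - y \<in> ortho_compl M \<Longrightarrow> Q x = y"
    by (rule orthogonal_projection[OF M]) (rule that)
  have QM: "Q x = x" if "x \<in> M" for x
    using that closed_csubspaceD(2)[OF closed_csubspace_ortho_compl] by (intro Q(4)) auto
  have comm: "Q (T x) = T (Q x)"
    if T: "bounded_op UNIV T" "T ` M \<subseteq> M" "T ` ortho_compl M \<subseteq> ortho_compl M" for T x
  proof (rule Q(4))
    show "T (Q x) \<in> M" using T Q by blast
    have "T (x - Q x) \<in> ortho_compl M" using T Q by blast
    then show "T x - T (Q x) \<in> ortho_compl M" by (simp add: bounded_op_UNIVD[OF T(1)])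
  qed
  note Q_comm = comm[OF ABP(1) A] comm[OF ABP(2) B] comm[OF ABP(3) P]
  note ABP_M = bounded_op_subspace[OF ABP(1) A(1)] bounded_op_subspace[OF ABP(2) B(1)]
    bounded_op_subspace[OF ABP(3) P(1)]
  have triple: "commuting_triple M A B P"
    unfolding commuting_triple_def
    using M ABP_M E_contractionD(5-7)[OF E] by simp
  have "taylor_spectrum M A B P \<subseteq> taylor_spectrum UNIV A B P"
  proof -
    have "koszul_exact M (\<lambda>x. A x - a *\<^sub>C x) (\<lambda>x. B x - b *\<^sub>C x) (\<lambda>x. P x - p *\<^sub>C x)"
      if "koszul_exact UNIV (\<lambda>x. A x - a *\<^sub>C x) (\<lambda>x. B x - b *\<^sub>C x) (\<lambda>x. P x - p *\<^sub>C x)" for a b p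
      by (rule koszul_exact_retract[OF M that Q(1,2) QM])
        (simp_all add: bounded_op_UNIVD[OF Q(1)] Q_comm)
    then show ?thesis unfolding taylor_spectrum_def by auto
  qed
  also have "\<dots> \<subseteq> closure tetrablock" using E by (simp add: E_contraction_def spectral_set_def)
  finally have spectrum: "taylor_spectrum M A B P \<subseteq> closure tetrablock" .
  have "opnorm M (rat3_op M f g A B P)
      \<le> (SUP z\<in>closure tetrablock. cmod (poly3_eval f z / poly3_eval g z))" (is "_ \<le> ?c")
    if nz: "\<forall>z\<in>closure tetrablock. poly3_eval g z \<noteq> 0" for f g
  proof -
    let ?f = "poly3_op f A B P" and ?g = "poly3_op g A B P"
    have "continuous_on (closure tetrablock) (\<lambda>z. cmod (poly3_eval f z / poly3_eval g z))"
      using nz by (intro continuous_intros continuous_on_poly3_eval) auto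
    then have "compact ((\<lambda>z. cmod (poly3_eval f z / poly3_eval g z)) ` closure tetrablock)"
      by (rule compact_continuous_image[OF _ E_contractionD(4)[OF E]])
    then have bdd: "bdd_above ((\<lambda>z. cmod (poly3_eval f z / poly3_eval g z)) ` closure tetrablock)"
      by (intro bounded_imp_bdd_above compact_imp_bounded)
    have up: "cmod (poly3_eval f z / poly3_eval g z) \<le> ?c" if "z \<in> closure tetrablock" for z
      by (rule cSUP_upper[OF that bdd])
    have "0 \<le> cmod (poly3_eval f (0, 0, 0) / poly3_eval g (0, 0, 0))" by simp
    also have "\<dots> \<le> ?c" by (rule up) (use zero_in_tetrablock closure_subset in blast)
    finally have c: "0 \<le> ?c" .
    have le: "norm (?f x) \<le> ?c * norm (?g x)" for x
      by (rule rational_bound[OF E]) (use up nz in \<open>auto simp: norm_divide divide_le_eq\<close>)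
    have bij: "bij ?g" using poly3_op_invertible[OF E] nz by blast
    have "norm (rat3_op M f g A B P x) / norm x \<le> ?c" if x: "x \<in> M" for x
    proof -
      obtain y where y: "?g y = x" using bij by (metis bij_pointE)
      have "?g (Q y) = Q x" using poly3_op_commute[of Q A B P g y, OF Q(1) Q_comm] y by simp
      then have "x \<in> ?g ` M" using Q(2) QM[OF x] by (metis imageI)
      then have "?g (inv_into M ?g x) = x" by (rule f_inv_into_f)
      then have "norm (rat3_op M f g A B P x) \<le> ?c * norm x"
        using le[of "inv_into M ?g x"] by (simp add: rat3_op_def)
      then show ?thesis using c by (cases "x = 0") (simp_all add: divide_le_eq)
    qed
    then show ?thesis
      unfolding opnorm_def using closed_csubspaceD(2)[OF M] by (intro cSUP_least) auto
  qed
  then show ?thesis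
    unfolding E_contraction_def spectral_set_def
    using triple spectrum E_contractionD(4)[OF E] by blast
qed

section \<open>Subspaces on which the last component is unitary\<close>

text \<open>
  On approximate joint eigenvectors for \<open>(a, b, p)\<close> on which \<open>P\<close> is isometric, the operator inequalities turn into
  \<open>\<bar>p\<bar> = 1\<close>, \<open>\<bar>a\<bar> \<le> 1\<close> and \<open>\<bar>b - z p\<bar> \<le> \<bar>1 - z a\<bar>\<close>, which characterise the distinguished boundary. The
  constant \<open>\<delta>\<close> is the amount by which one of these conditions fails.
\<close>

lemma approximate_point_bound:
  fixes A B P :: "'a::complex_hilbert_space \<Rightarrow> 'a"
  assumes E: "E_contraction UNIV A B P" and notin: "(a, b, p) \<notin> b_tetrablock"
  obtains \<delta> where "\<delta> > 0" "\<And>x. norm (P x) = norm x \<Longrightarrow>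
    \<delta> * norm x \<le> norm (A x - a *\<^sub>C x) + norm (B x - b *\<^sub>C x) + norm (P x - p *\<^sub>C x)"
proof -
  note ABP = E_contractionD(1-3)[OF E]
  consider "cmod p \<noteq> 1" | "cmod a > 1" | z where "cmod z \<le> 1" "cmod (1 - z * a) < cmod (b - z * p)"
    using notin by (auto simp: b_tetrablock_def closure_tetrablock_iff not_le)
  then show ?thesis
  proof cases
    case 1
    show ?thesis
    proof (rule that)
      show "\<bar>1 - cmod p\<bar> > 0" using 1 by simp
      fix x assume x: "norm (P x) = norm x"
      have "\<bar>1 - cmod p\<bar> * norm x = \<bar>norm (P x) - norm (p *\<^sub>C x)\<bar>"
        using abs_mult[of "1 - cmod p" "norm x"] by (simp add: x norm_scaleC left_diff_distrib)
      also have "\<dots> \<le> norm (P x - p *\<^sub>C x)" by (rule norm_triangle_ineq3)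
      finally show "\<bar>1 - cmod p\<bar> * norm x
          \<le> norm (A x - a *\<^sub>C x) + norm (B x - b *\<^sub>C x) + norm (P x - p *\<^sub>C x)"
        by (simp add: add_increasing)
    qed
  next
    case 2
    show ?thesis
    proof (rule that)
      show "cmod a - 1 > 0" using 2 by simp
      fix x
      have "(cmod a - 1) * norm x \<le> norm (a *\<^sub>C x) - norm (A x)"
        using E_contraction_norm_A_le[OF E, of x] by (simp add: norm_scaleC algebra_simps)
      also have "\<dots> \<le> norm (A x - a *\<^sub>C x)"
        using norm_triangle_ineq2[of "a *\<^sub>C x" "A x"] by (simp add: norm_minus_commute)
      finally have "(cmod a - 1) * norm x \<le> norm (A x - a *\<^sub>C x)" .
      then show "(cmod a - 1) * norm x
          \<le> norm (A x - a *\<^sub>C x) + norm (B x - b *\<^sub>C x) + norm (P x - p *\<^sub>C x)"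
        using norm_ge_zero[of "B x - b *\<^sub>C x"] norm_ge_zero[of "P x - p *\<^sub>C x"] by linarith
    qed
  next
    case (3 z)
    show ?thesis
    proof (rule that)
      show "cmod (b - z * p) - cmod (1 - z * a) > 0" using 3 by simp
      fix x
      let ?\<alpha> = "A x - a *\<^sub>C x" and ?\<beta> = "B x - b *\<^sub>C x" and ?\<pi> = "P x - p *\<^sub>C x"
      have shrink: "norm (z *\<^sub>C v) \<le> norm v" for v :: 'a
        using mult_right_mono[OF 3(1), of "norm v"] by (simp add: norm_scaleC)
      have "(b - z * p) *\<^sub>C x = (B x - z *\<^sub>C P x) - ?\<beta> + z *\<^sub>C ?\<pi>"
        by (simp add: cvs.scale_left_diff_distrib cvs.scale_right_diff_distrib)
      then have "cmod (b - z * p) * norm x \<le> norm (B x - z *\<^sub>C P x) + norm ?\<beta> + norm ?\<pi>"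
        using norm_triangle_ineq[of "(B x - z *\<^sub>C P x) - ?\<beta>" "z *\<^sub>C ?\<pi>"]
          norm_triangle_ineq4[of "B x - z *\<^sub>C P x" ?\<beta>] shrink[of ?\<pi>]
        by (simp flip: norm_scaleC)
      moreover have "norm (B x - z *\<^sub>C P x) \<le> norm (x - z *\<^sub>C A x)"
        by (rule linear_fractional_bound[OF E 3(1)])
      moreover have "x - z *\<^sub>C A x = (1 - z * a) *\<^sub>C x - z *\<^sub>C ?\<alpha>"
        by (simp add: cvs.scale_left_diff_distrib cvs.scale_right_diff_distrib)
      then have "norm (x - z *\<^sub>C A x) \<le> cmod (1 - z * a) * norm x + norm ?\<alpha>"
        using norm_triangle_ineq4[of "(1 - z * a) *\<^sub>C x" "z *\<^sub>C ?\<alpha>"] shrink[of ?\<alpha>]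
        by (simp add: norm_scaleC)
      ultimately show "(cmod (b - z * p) - cmod (1 - z * a)) * norm x \<le> norm ?\<alpha> + norm ?\<beta> + norm ?\<pi>"
        by (simp add: left_diff_distrib)
    qed
  qed
qed

text \<open>
  The equality case gives \<open>A\<^sup>* = P\<^sup>* B\<close> and \<open>B\<^sup>* = P\<^sup>* A\<close> on \<open>N\<close>. As \<open>P\<^sup>* = P\<^sup>-\<^sup>1\<close> there, all adjoints are in the
  commutative algebra generated by \<open>A, B, P, P\<^sup>-\<^sup>1\<close>.
\<close>

lemma E_unitary_if_P_unitary:
  fixes A B P :: "'a::complex_hilbert_space \<Rightarrow> 'a"
  assumes E: "E_contraction UNIV A B P" and N: "closed_csubspace N"
    and inv: "\<And>x. x \<in> N \<Longrightarrow> A x \<in> N" "\<And>x. x \<in> N \<Longrightarrow> B x \<in> N" "\<And>x. x \<in> N \<Longrightarrow> P x \<in> N"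
    and inv': "\<And>x. x \<in> N \<Longrightarrow> adj UNIV P x \<in> N"
    and unitary: "\<And>x. x \<in> N \<Longrightarrow> P (adj UNIV P x) = x" "\<And>x. x \<in> N \<Longrightarrow> adj UNIV P (P x) = x"
  shows "E_unitary N A B P"
proof -
  note ABP = E_contractionD(1-3)[OF E] and AB = E_contractionD(5-7)[OF E, simplified]
  let ?S = "adj UNIV P"
  have iso: "norm (P x) = norm x" if "x \<in> N" for x
    by (rule norm_eq_if_adj_left_inverse[OF ABP(3) unitary(2)[OF that]])
  have adjoint: "cinner (?S (B y)) x = cinner y (A x)" "cinner (?S (A y)) x = cinner y (B x)"
    if "x \<in> N" "y \<in> N" for x y
    using cinner_A_eq_if_norm_P_eq(2,4)[OF E iso, of y x] that
    by (simp_all add: cinner_adj'[OF ABP(3)])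
  note adjoint' = cinner_A_eq_if_norm_P_eq(2,4)[OF E iso]
  have S_comm: "A (?S x) = ?S (A x)" "B (?S x) = ?S (B x)" if "x \<in> N" for x
  proof -
    have "?S (P (A (?S x))) = A (?S x)" "?S (P (B (?S x))) = B (?S x)"
      using that by (simp_all add: unitary inv inv')
    then show "A (?S x) = ?S (A x)" "B (?S x) = ?S (B x)"
      using that by (simp_all add: AB[symmetric] unitary)
  qed
  have ABP_N: "bounded_op N A" "bounded_op N B" "bounded_op N P" and S_N: "bounded_op N ?S"
    using inv inv' by (auto intro!: bounded_op_subspace ABP bounded_op_adj)
  note ops = inv inv' S_comm unitary AB
  have adj_N: "adj N A x = ?S (B x)" "adj N B x = ?S (A x)" "adj N P x = ?S x" if "x \<in> N" for x
    using that
    by (auto intro!: adj_eqI[OF N] simp: inv inv' cinner_adj[OF ABP(3)] adjoint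
        cinner_commute[of "A _" x] cinner_commute[of "B _" x] cinner_commute[of _ "?S _"] simp flip: adjoint)
  have normal: "normal_op N A" "normal_op N B" "normal_op N P"
    unfolding normal_op_def using ABP_N by (auto simp: adj_N ops)
  have triple: "commuting_triple N A B P"
    unfolding commuting_triple_def using N ABP_N AB by simp
  have "koszul_exact N (\<lambda>x. A x - a *\<^sub>C x) (\<lambda>x. B x - b *\<^sub>C x) (\<lambda>x. P x - p *\<^sub>C x)"
    if abp: "(a, b, p) \<notin> b_tetrablock" for a b p
  proof -
    obtain \<delta> where \<delta>: "\<delta> > 0" "\<And>x. norm (P x) = norm x \<Longrightarrow>
        \<delta> * norm x \<le> norm (A x - a *\<^sub>C x) + norm (B x - b *\<^sub>C x) + norm (P x - p *\<^sub>C x)"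
      using approximate_point_bound[OF E abp] by blast
    note lin = bounded_opD[OF N ABP_N(1)] bounded_opD[OF N ABP_N(2)] bounded_opD[OF N ABP_N(3)]
      bounded_opD[OF N S_N] closed_csubspaceD[OF N]
    show ?thesis
    proof (rule koszul_exact_if_bounded_below[OF N,
          where R' = "\<lambda>x. ?S (B x) - cnj a *\<^sub>C x" and S' = "\<lambda>x. ?S (A x) - cnj b *\<^sub>C x"
            and T' = "\<lambda>x. ?S x - cnj p *\<^sub>C x" and \<delta> = \<delta>])
      show "\<delta> * norm x \<le> norm (A x - a *\<^sub>C x) + norm (B x - b *\<^sub>C x) + norm (P x - p *\<^sub>C x)"
        if "x \<in> N" for x
        by (rule \<delta>(2)[OF iso[OF that]])
    qed (auto simp: ops lin cvs.scale_right_diff_distrib cvs.scale_left_commute cinner_simps adjoint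
          cinner_adj'[OF ABP(3)] adjoint'[symmetric] algebra_simps
          intro!: bounded_op_diff_scaleC N ABP_N bounded_op_id S_N bounded_op_comp[OF S_N ABP_N(1)] bounded_op_comp[OF S_N ABP_N(2)] \<delta>)
  qed
  then have "taylor_spectrum N A B P \<subseteq> b_tetrablock" unfolding taylor_spectrum_def by auto
  then show ?thesis unfolding E_unitary_def using triple normal by blast
qed

section \<open>The decomposition\<close>

theorem theorem5p9:
  fixes A B P :: "'a::complex_hilbert_space \<Rightarrow> 'a" and Z :: "'a set"
  assumes "E_contraction UNIV A B P"
    and "Z = {x. \<forall>y. (\<lambda>k. cinner ((P ^^ k) x) y) \<longlonglongrightarrow> 0}"
  shows "(reduces Z A \<and> reduces Z B \<and> reduces (ortho_compl Z) A \<and> reduces (ortho_compl Z) B) \<and>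
    weakly_stable_E_contraction Z A B P \<and>
    E_unitary (ortho_compl Z) A B P"
proof -
  note E = assms(1)
  have Z: "Z = weakly_stable_part P" by (simp add: assms(2) weakly_stable_part_def)
  note ABP = E_contractionD(1-3)[OF E] and AB = E_contractionD(5-7)[OF E, simplified]
  note contr = E_contraction_norm_P_le[OF E]
  let ?N = "ortho_compl Z"
  have clZ: "closed_csubspace Z"
    unfolding Z by (rule closed_csubspace_weakly_stable_part[OF ABP(3) contr])
  have clN: "closed_csubspace ?N" by (rule closed_csubspace_ortho_compl)
  have invZ: "A x \<in> Z" "B x \<in> Z" "P x \<in> Z" if "x \<in> Z" for x
    using that AB ABP unfolding Z by (auto intro: weakly_stable_part_commutant)
  have adjZ: "adj UNIV P x \<in> Z" if "x \<in> Z" for x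
    using that unfolding Z by (rule weakly_stable_part_adj[OF ABP(3) contr])
  have unitary: "P (adj UNIV P x) = x" "adj UNIV P (P x) = x" if "x \<in> ?N" for x
    using that unitary_on_ortho_compl_weakly_stable_part[OF ABP(3) contr] unfolding Z by blast+
  have P_N: "P x \<in> ?N" "adj UNIV P x \<in> ?N" if "x \<in> ?N" for x
    using that ortho_compl_invariant_if_adj_invariant[OF ABP(3) adjZ]
      ortho_compl_adj_invariant[OF ABP(3) invZ(3)] by blast+
  have AB_N: "A x \<in> ?N" "B x \<in> ?N" if x: "x \<in> ?N" for x
  proof -
    have iso: "norm (P x) = norm x"
      by (rule norm_eq_if_adj_left_inverse[OF ABP(3) unitary(2)[OF x]])
    \<comment> \<open>The next identities say \<open>A x = B\<^sup>* P x\<close> and \<open>B x = A\<^sup>* P x\<close>, and \<open>B\<^sup>*\<close>, \<open>A\<^sup>*\<close> preserve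
      the orthogonal complement of \<open>Z\<close>.\<close>
    have "cinner (P x) w = 0" if "w \<in> Z" for w
      using P_N(1)[OF x] that cinner_eq_zero_commute unfolding ortho_compl_def by blast
    then have "cinner (A x) y = 0" "cinner (B x) y = 0" if "y \<in> Z" for y
      using that by (simp_all add: cinner_A_eq_if_norm_P_eq(1,3)[OF E iso] invZ)
    then show "A x \<in> ?N" "B x \<in> ?N"
      using cinner_eq_zero_commute unfolding ortho_compl_def by blast+
  qed
  have "reduces Z A" "reduces Z B"
    unfolding reduces_def using clZ invZ AB_N
    by (auto intro: adj_invariant_if_ortho_compl_invariant[OF clZ] ABP)
  moreover have "reduces ?N A" "reduces ?N B"
    unfolding reduces_def using clN AB_N invZ by (auto intro: ortho_compl_adj_invariant ABP)
  moreover have "E_contraction Z A B P"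
    by (rule E_contraction_reducing[OF E clZ]) (use invZ AB_N P_N in blast)+
  moreover have "weakly_stable Z P" by (simp add: weakly_stable_def assms(2))
  moreover have "E_unitary ?N A B P"
    by (rule E_unitary_if_P_unitary[OF E clN AB_N P_N unitary])
  ultimately show ?thesis by (simp add: weakly_stable_E_contraction_def)
qed

end
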